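(* Let $f$ be a Bernstein function with triplet $(0,0,\mu)$. Let $T_t:L^1(0,\infty)\to L^1(0,\infty)$, $T_t\phi(x):=\phi^\circ(x-t)$, $x,t>0$, be the shift semigroup on the half-line, and denote by $-f\left(\frac{d}{dx}\right)$ the generator of the semigroup on $L^1(0,\infty)$ that arises via Bochner's subordination (with respect to $f$) of the shift semigroup. Then $\mathcal D\big(D^f_{\mathrm R}\big)$ is its domain and $f\left(\frac{d}{dx}\right)=D^f_{\mathrm R}$.
   Context: A Bernstein function with triplet $(a,b,\mu)$ is a function $f(\lambda)=a+b\lambda+\int_{(0,\infty)}(1-e^{-\lambda t})\,\mu(dt)$, $\lambda>0$, with $a,b\ge0$ and $\mu$ a Borel measure on $(0,\infty)$ with $\int\min\{1,t\}\,\mu(dt)<\infty$. For $\phi:(0,\infty)\to\mathbb R$, $\phi^\circ$ is the extension to $\mathbb R$ by $0$ on $(-\infty,0]$. Approximations: for $n\in\mathbb N$, $f_n=\frac{nf}{n+f}$. Since $\frac{n}{n+f}$ is completely monotone, it is the Laplace transform of a probability measure $\rho_n$, so $f_n(x)=n\int_{(0,\infty)}(1-e^{-tx})\,\rho_n(dt)$. The bounded operator $D^{f_n}_{\mathrm R}$ on $L^1(0,\infty)$ is $$D^{f_n}_{\mathrm R}\phi(x)=\int_{(0,\infty)}\big(\phi^\circ(x)-\phi^\circ(x-t)\big)\,n\rho_n(dt).$$ The Bernstein–Riemann–Liouville derivative $D^f_{\mathrm R}$ in $L^1(0,\infty)$ has the domain $$\mathcal D\big(D^f_{\mathrm R}\big)=\Big\{\phi\in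 L^1(0,\infty):\ \exists\,\psi\in L^1(0,\infty),\ \lim_{n\to\infty}\big\|D^{f_n}_{\mathrm R}\phi-\psi\big\|_{L^1(0,\infty)}=0\Big\},\qquad D^f_{\mathrm R}\phi:=\psi .$$ Bochner subordination: if $(S_t)_{t\ge0}$ is the subordinator with $\mathbb E e^{-\lambda S_t}=e^{-tf(\lambda)}$, the subordinate semigroup is $T^f_t\phi=\int_{[0,\infty)}T_s\phi\;\mathbb P(S_t\in ds)$ (Bochner integral), with $T_0$ the identity; its generator is the usual generator of a strongly continuous semigroup. *)

theory Defs
  imports "HOL-Probability.Probability"
begin

section \<open>The Banach space of integrable functions on the half-line\<close>

text \<open>
  Functions on the half-line are represented by functions on \<^typ>\<open>real\<close> whose values
  outside \<^term>\<open>{0::real<..}\<close> are irrelevant.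
\<close>

definition half_line :: "real measure" where
  "half_line = restrict_space lborel {0<..}"

lemma space_half_line [simp]: "space half_line = {0<..}"
  by (simp add: half_line_def space_restrict_space)

lemma borel_measurable_half_line [measurable (raw)]:
  "f \<in> borel_measurable borel \<Longrightarrow> f \<in> borel_measurable half_line"
  unfolding half_line_def by (intro measurable_restrict_space1) simp

quotient_type L1 = "real \<Rightarrow> real" /
  partial: "\<lambda>f g. integrable half_line f \<and> integrable half_line g \<and> (AE x in half_line. f x = g x)"
proof (rule part_equivpI)
  show "\<exists>f. integrable half_line f \<and> integrable half_line f \<and> (AE x in half_line. (f x::real) = f x)"
    by (rule exI[of _ "\<lambda>_. 0"]) simp
  show "symp (\<lambda>f g :: real \<Rightarrow> real. integrable half_line f \<and> integrable half_line g \<and> (AE x in half_line. f x = g x))"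
    by (rule sympI) (auto elim: eventually_mono)
  show "transp (\<lambda>f g :: real \<Rightarrow> real. integrable half_line f \<and> integrable half_line g \<and> (AE x in half_line. f x = g x))"
    by (rule transpI) (auto elim: eventually_elim2)
qed

instantiation L1 :: real_vector
begin

lift_definition zero_L1 :: L1 is "\<lambda>_. 0" by simp

lift_definition plus_L1 :: "L1 \<Rightarrow> L1 \<Rightarrow> L1" is "\<lambda>f g x. f x + g x"
  by (auto elim: eventually_elim2)

lift_definition uminus_L1 :: "L1 \<Rightarrow> L1" is "\<lambda>f x. - f x"
  by (auto elim: eventually_mono)

lift_definition minus_L1 :: "L1 \<Rightarrow> L1 \<Rightarrow> L1" is "\<lambda>f g x. f x - g x"
  by (auto elim: eventually_elim2)

lift_definition scaleR_L1 :: "real \<Rightarrow> L1 \<Rightarrow> L1" is "\<lambda>c f x. c * f x"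
  by (auto elim: eventually_mono)

instance
proof
  fix f g h :: L1 and a b :: real
  show "f + g + h = f + (g + h)" by transfer (auto simp: algebra_simps)
  show "f + g = g + f" by transfer (auto simp: algebra_simps)
  show "0 + f = f" by transfer auto
  show "- f + f = 0" by transfer auto
  show "f - g = f + - g" by transfer auto
  show "a *\<^sub>R (f + g) = a *\<^sub>R f + a *\<^sub>R g" by transfer (auto simp: algebra_simps)
  show "(a + b) *\<^sub>R f = a *\<^sub>R f + b *\<^sub>R f" by transfer (auto simp: algebra_simps)
  show "a *\<^sub>R b *\<^sub>R f = (a * b) *\<^sub>R f" by transfer (auto simp: algebra_simps)
  show "1 *\<^sub>R f = f" by transfer auto
qed

end

instantiation L1 :: real_normed_vector
begin

lift_definition norm_L1 :: "L1 \<Rightarrow> real" is "\<lambda>f. \<integral>x. \<bar>f x\<bar> \<partial>half_line"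
  by (rule integral_cong_AE) (auto elim: eventually_mono)

definition dist_L1 :: "L1 \<Rightarrow> L1 \<Rightarrow> real" where "dist_L1 f g = norm (f - g)"

definition sgn_L1 :: "L1 \<Rightarrow> L1" where "sgn_L1 f = f /\<^sub>R norm f"

definition uniformity_L1 :: "(L1 \<times> L1) filter" where
  "uniformity_L1 = (INF e\<in>{0<..}. principal {(x, y). dist x y < e})"

definition open_L1 :: "L1 set \<Rightarrow> bool" where
  "open_L1 U \<longleftrightarrow> (\<forall>x\<in>U. eventually (\<lambda>(x', y). x' = x \<longrightarrow> y \<in> U) uniformity)"

instance
proof
  fix f g :: L1 and a :: real
  show "dist f g = norm (f - g)" by (rule dist_L1_def)
  show "sgn f = f /\<^sub>R norm f" by (rule sgn_L1_def)
  show "uniformity = (INF e\<in>{0<..}. principal {(x::L1, y). dist x y < e})"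
    by (rule uniformity_L1_def)
  show "open U \<longleftrightarrow> (\<forall>x\<in>U. eventually (\<lambda>(x', y). x' = x \<longrightarrow> y \<in> U) uniformity)" for U :: "L1 set"
    by (rule open_L1_def)
  show "norm f = 0 \<longleftrightarrow> f = 0"
    by transfer (auto simp: integral_nonneg_eq_0_iff_AE)
  show "norm (f + g) \<le> norm f + norm g"
  proof transfer
    fix f g :: "real \<Rightarrow> real"
    assume "integrable half_line f \<and> integrable half_line f \<and> (AE x in half_line. f x = f x)"
      and "integrable half_line g \<and> integrable half_line g \<and> (AE x in half_line. g x = g x)"
    then have [simp]: "integrable half_line f" "integrable half_line g" by auto
    have "(\<integral>x. \<bar>f x + g x\<bar> \<partial>half_line) \<le> (\<integral>x. \<bar>f x\<bar> + \<bar>g x\<bar> \<partial>half_line)"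
      by (rule integral_mono) auto
    then show "(\<integral>x. \<bar>f x + g x\<bar> \<partial>half_line) \<le> (\<integral>x. \<bar>f x\<bar> \<partial>half_line) + (\<integral>x. \<bar>g x\<bar> \<partial>half_line)"
      by simp
  qed
  show "norm (a *\<^sub>R f) = \<bar>a\<bar> * norm f"
    by transfer (simp add: abs_mult)
qed

end

lemma integrable_rep_L1 [simp]: "integrable half_line (rep_L1 f)"
  using Quotient3_rep_reflp[OF Quotient3_L1, of f] by auto

lemma abs_rep_L1 [simp]: "abs_L1 (rep_L1 f) = f"
  by (rule Quotient3_abs_rep[OF Quotient3_L1])

lemma abs_L1_eq_iff:
  "integrable half_line f \<Longrightarrow> integrable half_line g \<Longrightarrow>
    abs_L1 f = abs_L1 g \<longleftrightarrow> (AE x in half_line. f x = g x)"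
  using Quotient3_rel[OF Quotient3_L1, of f g] by auto

lemma L1_cases:
  obtains f where "integrable half_line f" "F = abs_L1 f"
  by (metis integrable_rep_L1 abs_rep_L1)

lemma indicator_empty': "indicator {} = (\<lambda>_. 0 :: real)"
  by auto

lemma abs_L1_plus:
  "integrable half_line f \<Longrightarrow> integrable half_line g \<Longrightarrow> abs_L1 f + abs_L1 g = abs_L1 (\<lambda>x. f x + g x)"
  by (rule plus_L1.abs_eq) auto

lemma abs_L1_minus:
  "integrable half_line f \<Longrightarrow> integrable half_line g \<Longrightarrow> abs_L1 f - abs_L1 g = abs_L1 (\<lambda>x. f x - g x)"
  by (rule minus_L1.abs_eq) auto

lemma abs_L1_scaleR:
  "integrable half_line f \<Longrightarrow> c *\<^sub>R abs_L1 f = abs_L1 (\<lambda>x. c * f x)"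
  by (rule scaleR_L1.abs_eq) auto

lemma norm_abs_L1:
  "integrable half_line f \<Longrightarrow> norm (abs_L1 f) = (\<integral>x. \<bar>f x\<bar> \<partial>half_line)"
  by (rule norm_L1.abs_eq) auto

lemma tendsto_abs_L1_dominated:
  assumes f: "f \<in> borel_measurable half_line" and s: "\<And>n. s n \<in> borel_measurable half_line"
    and w: "integrable half_line w"
    and lim: "AE x in half_line. (\<lambda>n. s n x) \<longlonglongrightarrow> f x"
    and bound: "\<And>n. AE x in half_line. \<bar>s n x\<bar> \<le> w x"
  shows "(\<lambda>n. abs_L1 (s n)) \<longlonglongrightarrow> abs_L1 f"
proof -
  note [measurable] = f s
  have int: "integrable half_line f" "integrable half_line (s n)" for n
    using integrable_dominated_convergence[OF f s w lim]
      integrable_dominated_convergence2[OF f s w lim] bound by auto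
  have "(\<lambda>n. \<integral>x. \<bar>s n x - f x\<bar> \<partial>half_line) \<longlonglongrightarrow> (\<integral>x. 0 \<partial>half_line)"
  proof (rule integral_dominated_convergence)
    show "integrable half_line (\<lambda>x. w x + \<bar>f x\<bar>)" using w int by simp
    show "AE x in half_line. (\<lambda>n. \<bar>s n x - f x\<bar>) \<longlonglongrightarrow> 0"
      using lim by eventually_elim (simp add: LIM_zero tendsto_rabs_zero)
    show "AE x in half_line. norm \<bar>s n x - f x\<bar> \<le> w x + \<bar>f x\<bar>" for n
      using bound[of n] by eventually_elim auto
  qed simp_all
  then show ?thesis
    by (subst tendsto_dist_iff) (simp add: dist_norm abs_L1_minus norm_abs_L1 int)
qed

instance L1 :: banach
proof
  fix X :: "nat \<Rightarrow> L1"
  assume C: "Cauchy X"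
  have "\<exists>N. \<forall>m\<ge>N. \<forall>n\<ge>N. dist (X m) (X n) < (1/2)^k" for k
    using C by (auto simp: Cauchy_def)
  then obtain N where N: "\<And>k m n. m \<ge> N k \<Longrightarrow> n \<ge> N k \<Longrightarrow> dist (X m) (X n) < (1/2)^k"
    by metis
  define r where "r = rec_nat (N 0) (\<lambda>k m. max (Suc m) (N (Suc k)))"
  have r_Suc: "r (Suc k) = max (Suc (r k)) (N (Suc k))" for k by (simp add: r_def)
  have r_ge: "r k \<ge> N k" for k by (cases k) (simp_all add: r_def)
  have mono: "strict_mono r" by (rule strict_monoI_Suc) (simp add: r_Suc)
  define g where "g k = rep_L1 (X (r k))" for k
  define d where "d k x = g (Suc k) x - g k x" for k x
  have int_g [simp]: "integrable half_line (g k)" for k by (simp add: g_def)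
  have abs_g: "abs_L1 (g k) = X (r k)" for k by (simp add: g_def)
  have int_d [simp]: "integrable half_line (d k)" for k unfolding d_def by simp
  have [measurable]: "g k \<in> borel_measurable half_line" "d k \<in> borel_measurable half_line" for k
    by (simp_all add: borel_measurable_integrable)
  have nd: "(\<integral>x. \<bar>d k x\<bar> \<partial>half_line) < (1/2)^k" for k
  proof -
    have "(\<integral>x. \<bar>d k x\<bar> \<partial>half_line) = dist (X (r (Suc k))) (X (r k))"
      by (simp add: d_def dist_norm abs_g[symmetric] abs_L1_minus norm_abs_L1)
    also have "\<dots> < (1/2)^k"
      using r_ge[of k] strict_monoD[OF mono, of k "Suc k"] by (intro N) auto
    finally show ?thesis .
  qed
  have sum_int: "summable (\<lambda>k. \<integral>x. \<bar>d k x\<bar> \<partial>half_line)"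
    by (rule summable_comparison_test[of _ "\<lambda>k. (1/2)^k"])
      (auto intro!: exI[of _ 0] less_imp_le[OF nd] simp: summable_geometric)
  have "(\<integral>\<^sup>+x. (\<Sum>k. ennreal \<bar>d k x\<bar>) \<partial>half_line) = (\<Sum>k. \<integral>\<^sup>+x. ennreal \<bar>d k x\<bar> \<partial>half_line)"
    by (intro nn_integral_suminf) simp
  also have "\<dots> = (\<Sum>k. ennreal (\<integral>x. \<bar>d k x\<bar> \<partial>half_line))"
    by (intro arg_cong[where f=suminf] ext nn_integral_eq_integral) auto
  also have "\<dots> \<noteq> \<infinity>"
    using sum_int by (simp add: ennreal_suminf_neq_top)
  finally have "AE x in half_line. (\<Sum>k. ennreal \<bar>d k x\<bar>) \<noteq> \<infinity>"
    by (intro nn_integral_PInf_AE) auto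
  then have AE_sum: "AE x in half_line. summable (\<lambda>k. \<bar>d k x\<bar>)"
    by eventually_elim (auto intro: summable_suminf_not_top)
  have int_w: "integrable half_line (\<lambda>x. \<Sum>k. \<bar>d k x\<bar>)"
    by (rule integrable_suminf) (use AE_sum sum_int in auto)
  define G where "G x = g 0 x + (\<Sum>k. d k x)" for x
  have tele: "g n x = g 0 x + (\<Sum>k<n. d k x)" for n x
    by (induction n) (simp_all add: d_def)
  have "(\<lambda>n. abs_L1 (g n)) \<longlonglongrightarrow> abs_L1 G"
  proof (rule tendsto_abs_L1_dominated)
    show "G \<in> borel_measurable half_line" unfolding G_def by measurable
    show "g n \<in> borel_measurable half_line" for n by measurable
    show "integrable half_line (\<lambda>x. \<bar>g 0 x\<bar> + (\<Sum>k. \<bar>d k x\<bar>))" using int_w by simp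
    show "AE x in half_line. (\<lambda>n. g n x) \<longlonglongrightarrow> G x"
      using AE_sum
    proof eventually_elim
      case (elim x)
      then have "(\<lambda>n. \<Sum>k<n. d k x) \<longlonglongrightarrow> (\<Sum>k. d k x)"
        by (rule summable_LIMSEQ[OF summable_rabs_cancel])
      then have "(\<lambda>n. g 0 x + (\<Sum>k<n. d k x)) \<longlonglongrightarrow> G x"
        unfolding G_def by (rule tendsto_add[OF tendsto_const])
      then show ?case by (simp add: tele[symmetric])
    qed
    show "AE x in half_line. \<bar>g n x\<bar> \<le> \<bar>g 0 x\<bar> + (\<Sum>k. \<bar>d k x\<bar>)" for n
      using AE_sum
    proof eventually_elim
      case (elim x)
      have "\<bar>g n x\<bar> \<le> \<bar>g 0 x\<bar> + \<bar>\<Sum>k<n. d k x\<bar>" using abs_triangle_ineq[of "g 0 x" "\<Sum>k<n. d k x"] by (simp add: tele[symmetric])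
      also have "\<bar>\<Sum>k<n. d k x\<bar> \<le> (\<Sum>k<n. \<bar>d k x\<bar>)" by (rule sum_abs)
      also have "\<dots> \<le> (\<Sum>k. \<bar>d k x\<bar>)" by (rule sum_le_suminf[OF elim]) auto
      finally show ?case by simp
    qed
  qed
  then have "(X \<circ> r) \<longlonglongrightarrow> abs_L1 G" by (simp add: abs_g comp_def)
  then have "X \<longlonglongrightarrow> abs_L1 G" by (rule Cauchy_converges_subseq[OF C mono])
  then show "convergent X" by (rule convergentI)
qed

text \<open>
  Separability, which the Bochner integral of the library requires: the rational linear
  combinations of indicators of intervals with rational right end point are dense.
\<close>

definition L1_step :: "real \<Rightarrow> L1" where
  "L1_step q = abs_L1 (indicator {..q})"

definition L1_simple :: "(rat \<times> rat) list \<Rightarrow> L1" where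
  "L1_simple xs = (\<Sum>(c, q)\<leftarrow>xs. of_rat c *\<^sub>R L1_step (of_rat q))"

lemma emeasure_half_line:
  "A \<in> sets borel \<Longrightarrow> emeasure half_line (A \<inter> {0<..}) = emeasure lborel (A \<inter> {0<..})"
  unfolding half_line_def by (subst emeasure_restrict_space) auto

lemma integrable_half_line_iff:
  fixes f :: "real \<Rightarrow> real"
  shows "integrable half_line f \<longleftrightarrow> integrable lborel (\<lambda>x. indicator {0<..} x * f x)"
  unfolding half_line_def by (subst integrable_restrict_space) auto

lemma integrable_half_line_indicator [simp]:
  assumes "A \<in> sets borel"
  shows "integrable half_line (indicator (A \<inter> {..k::real}) :: real \<Rightarrow> real)"
proof -
  have "integrable lborel (indicator (A \<inter> {0<..k}) :: real \<Rightarrow> real)"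
  proof (rule integrable_real_indicator)
    show "A \<inter> {0<..k} \<in> sets lborel" using assms by simp
    have "emeasure lborel (A \<inter> {0<..k}) \<le> emeasure lborel {0<..k}"
      by (rule emeasure_mono) auto
    also have "\<dots> < \<infinity>" by (cases "0 \<le> k") auto
    finally show "emeasure lborel (A \<inter> {0<..k}) < \<infinity>" .
  qed
  moreover have "indicator (A \<inter> {0<..k}) = (\<lambda>x. indicator {0<..} x * indicator (A \<inter> {..k}) x :: real)"
    by (auto split: split_indicator)
  ultimately show ?thesis by (simp add: integrable_half_line_iff)
qed

lemma integrable_half_line_atMost [simp]:
  "integrable half_line (indicator {..k::real} :: real \<Rightarrow> real)"
  using integrable_half_line_indicator[of UNIV k] by simp

lemma L1_simple_append: "L1_simple (xs @ ys) = L1_simple xs + L1_simple ys"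
  by (simp add: L1_simple_def)

lemma L1_simple_scale:
  "of_rat r *\<^sub>R L1_simple xs = L1_simple (map (\<lambda>(c, q). (r * c, q)) xs)"
  by (induction xs) (auto simp: L1_simple_def of_rat_mult scaleR_add_right)

lemma closure_L1_simple_add:
  assumes "f \<in> closure (range L1_simple)" "g \<in> closure (range L1_simple)"
  shows "f + g \<in> closure (range L1_simple)"
proof -
  obtain u v where "\<And>n::nat. u n \<in> range L1_simple" "u \<longlonglongrightarrow> f" "\<And>n::nat. v n \<in> range L1_simple" "v \<longlonglongrightarrow> g"
    using assms unfolding closure_sequential by blast
  then show ?thesis
    unfolding closure_sequential
    by (intro exI[of _ "\<lambda>n. u n + v n"] conjI tendsto_add)
      (metis L1_simple_append rangeE rangeI)+
qed

lemma closure_L1_simple_scaleR: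
  assumes f: "f \<in> closure (range L1_simple)"
  shows "c *\<^sub>R f \<in> closure (range L1_simple)"
proof -
  obtain u where u: "\<And>n::nat. u n \<in> range L1_simple" "u \<longlonglongrightarrow> f"
    using f unfolding closure_sequential by blast
  have "\<exists>r::rat. \<bar>of_rat r - c\<bar> < 1 / Suc n" for n
  proof -
    have "c < c + 1 / Suc n" by simp
    then obtain q :: rat where "c < of_rat q" "of_rat q < c + 1 / Suc n"
      using of_rat_dense by blast
    then have "\<bar>of_rat q - c\<bar> < 1 / Suc n" by linarith
    then show ?thesis ..
  qed
  then obtain r :: "nat \<Rightarrow> rat" where r: "\<And>n. \<bar>of_rat (r n) - c\<bar> < 1 / Suc n" by metis
  have "norm (of_rat (r n) - c) \<le> inverse (real (Suc n))" for n
    using r[of n] by (simp add: inverse_eq_divide)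
  then have "(\<lambda>n. of_rat (r n) - c) \<longlonglongrightarrow> 0"
    by (intro Lim_null_comparison[OF _ LIMSEQ_inverse_real_of_nat] always_eventually allI)
  then have rc: "(\<lambda>n. of_rat (r n) :: real) \<longlonglongrightarrow> c" by (simp add: LIM_zero_iff)
  show ?thesis
    unfolding closure_sequential
    using u(1) tendsto_scaleR[OF rc u(2)]
    by (intro exI[of _ "\<lambda>n. of_rat (r n) *\<^sub>R u n"] conjI) (metis L1_simple_scale rangeE rangeI)+
qed

lemma L1_step_in_closure: "L1_step a \<in> closure (range L1_simple)"
proof -
  have "\<exists>q::rat. a < of_rat q \<and> of_rat q < a + 1 / Suc n" for n
    by (rule of_rat_dense) simp
  then obtain q :: "nat \<Rightarrow> rat" where q: "\<And>n. a < of_rat (q n)" "\<And>n. of_rat (q n) < a + 1 / Suc n"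
    by metis
  have "norm (of_rat (q n) - a) \<le> inverse (real (Suc n))" for n
    using q[of n] by (simp add: inverse_eq_divide)
  then have "(\<lambda>n. of_rat (q n) - a) \<longlonglongrightarrow> 0"
    by (intro Lim_null_comparison[OF _ LIMSEQ_inverse_real_of_nat] always_eventually allI)
  then have qa: "(\<lambda>n. of_rat (q n) :: real) \<longlonglongrightarrow> a" by (simp add: LIM_zero_iff)
  have "(\<lambda>n. L1_step (of_rat (q n))) \<longlonglongrightarrow> L1_step a"
    unfolding L1_step_def
  proof (rule tendsto_abs_L1_dominated[where w = "indicator {..a + 1}"])
    show "AE x in half_line. (\<lambda>n. indicator {..of_rat (q n)} x :: real) \<longlonglongrightarrow> indicator {..a} x"
    proof (rule AE_I2)
      fix x :: real
      show "(\<lambda>n. indicator {..of_rat (q n)} x :: real) \<longlonglongrightarrow> indicator {..a} x"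
      proof (cases "x \<le> a")
        case True
        then have "x \<le> of_rat (q n)" for n using q(1)[of n] by linarith
        then show ?thesis using True by simp
      next
        case False
        then have "\<forall>\<^sub>F n in sequentially. of_rat (q n) < x"
          using order_tendstoD(2)[OF qa] by auto
        then show ?thesis using False
          by (intro tendsto_eventually) (auto elim!: eventually_mono)
      qed
    qed
    show "AE x in half_line. \<bar>indicator {..of_rat (q n)} x :: real\<bar> \<le> indicator {..a + 1} x" for n
    proof (rule AE_I2)
      fix x :: real
      have "1 / real (Suc n) \<le> 1" by simp
      then have "of_rat (q n) < a + 1" using q(2)[of n] by linarith
      then show "\<bar>indicator {..of_rat (q n)} x :: real\<bar> \<le> indicator {..a + 1} x"
        by (auto split: split_indicator)
    qed
  qed auto
  moreover have "L1_step (of_rat (q n)) = L1_simple [(1, q n)]" for n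
    by (simp add: L1_simple_def)
  ultimately show ?thesis
    unfolding closure_sequential by (intro exI[of _ "\<lambda>n. L1_step (of_rat (q n))"]) auto
qed

lemma closure_L1_simple_indicator:
  assumes "A \<in> sets borel"
  shows "abs_L1 (indicator (A \<inter> {..k::real})) \<in> closure (range L1_simple)"
proof -
  let ?V = "closure (range L1_simple)"
  have sets: "sets borel = sigma_sets UNIV (range (\<lambda>a::real. {..a}))"
    unfolding borel_eq_atMost by (simp add: sets_measure_of)
  have zero: "0 \<in> ?V"
    using closure_subset[of "range L1_simple"] by (force simp: L1_simple_def intro: rev_image_eqI[of "[]"])
  have diff: "f - g \<in> ?V" if "f \<in> ?V" "g \<in> ?V" for f g
    using closure_L1_simple_add[OF that(1) closure_L1_simple_scaleR[OF that(2), of "-1"]] by simp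
  have A: "A \<in> sigma_sets UNIV (range (\<lambda>a::real. {..a}))" using assms sets by simp
  have "Int_stable (range (\<lambda>a::real. {..a}))"
    by (auto simp: Int_stable_def)
  from this subset_Pow_Union[of "range (\<lambda>a::real. {..a})", THEN order_trans, OF Pow_mono[OF subset_UNIV]] A
  show ?thesis
  proof (induction rule: sigma_sets_induct_disjoint)
    case (basic A)
    then obtain a where "A = {..a}" by auto
    then have "A \<inter> {..k} = {..min a k}" by auto
    then show ?case using L1_step_in_closure[of "min a k"] by (simp add: L1_step_def)
  next
    case empty
    show ?case using zero by (simp add: zero_L1_def indicator_empty')
  next
    case (compl A)
    then have A: "A \<in> sets borel" using sets by simp
    have "(indicator ((UNIV - A) \<inter> {..k}) :: real \<Rightarrow> real) = (\<lambda>x. indicator {..k} x - indicator (A \<inter> {..k}) x)"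
      by (auto split: split_indicator)
    then have "abs_L1 (indicator ((UNIV - A) \<inter> {..k})) = L1_step k - abs_L1 (indicator (A \<inter> {..k}))"
      using A by (simp add: L1_step_def abs_L1_minus)
    then show ?case using diff L1_step_in_closure compl by simp
  next
    case (union A)
    then have A: "A i \<in> sets borel" for i using sets by auto
    note [measurable] = A
    have part: "abs_L1 (indicator ((\<Union>i<n. A i) \<inter> {..k})) \<in> ?V" for n :: nat
    proof (induction n)
      case 0
      show ?case using zero by (simp add: zero_L1_def indicator_empty')
    next
      case (Suc n)
      have "A n \<inter> A i = {}" if "i < n" for i
        using union(1) that by (simp add: disjoint_family_on_def)
      then have disj: "A n \<inter> (\<Union>i<n. A i) = {}" by blast
      have "(indicator ((\<Union>i<Suc n. A i) \<inter> {..k}) :: real \<Rightarrow> real) =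
          (\<lambda>x. indicator ((\<Union>i<n. A i) \<inter> {..k}) x + indicator (A n \<inter> {..k}) x)"
        using disj by (intro ext) (auto simp: lessThan_Suc split: split_indicator)
      then have "abs_L1 (indicator ((\<Union>i<Suc n. A i) \<inter> {..k})) =
          abs_L1 (indicator ((\<Union>i<n. A i) \<inter> {..k})) + abs_L1 (indicator (A n \<inter> {..k}))"
        by (subst abs_L1_plus) auto
      then show ?case using closure_L1_simple_add[OF Suc union(3)[of n]] by simp
    qed
    have "(\<lambda>n. abs_L1 (indicator ((\<Union>i<n. A i) \<inter> {..k}))) \<longlonglongrightarrow> abs_L1 (indicator ((\<Union>i. A i) \<inter> {..k}))"
    proof (rule tendsto_abs_L1_dominated[where w = "indicator {..k}"])
      show "AE x in half_line. (\<lambda>n. indicator ((\<Union>i<n. A i) \<inter> {..k}) x :: real)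
          \<longlonglongrightarrow> indicator ((\<Union>i. A i) \<inter> {..k}) x"
      proof (rule AE_I2)
        fix x
        show "(\<lambda>n. indicator ((\<Union>i<n. A i) \<inter> {..k}) x :: real) \<longlonglongrightarrow> indicator ((\<Union>i. A i) \<inter> {..k}) x"
          using LIMSEQ_indicator_UN[of "\<lambda>i. A i \<inter> {..k}" x] by simp
      qed
    qed (auto intro!: AE_I2 split: split_indicator)
    then show ?case
      using part by (rule closed_sequentially[OF closed_closure, rotated]) 
  qed
qed

lemma dense_L1_simple: "closure (range L1_simple) = UNIV"
proof -
  let ?V = "closure (range L1_simple)"
  have "abs_L1 f \<in> ?V" if "integrable half_line f" for f
    using that
  proof (induction rule: integrable_induct)
    case (base A c)
    have "A \<in> sets borel"
      using base(1) by (auto simp: half_line_def sets_restrict_space)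
    have *: "(\<lambda>n. abs_L1 (indicator (A \<inter> {..real n}))) \<longlonglongrightarrow> abs_L1 (indicator A)"
    proof (rule tendsto_abs_L1_dominated[where w = "indicator A"])
      show "integrable half_line (indicator A :: real \<Rightarrow> real)"
        using base by (intro integrable_real_indicator) auto
      show "AE x in half_line. (\<lambda>n. indicator (A \<inter> {..real n}) x :: real) \<longlonglongrightarrow> indicator A x"
      proof (rule AE_I2)
        fix x :: real
        obtain N :: nat where "x \<le> real N" using real_arch_simple by blast
        then have "indicator (A \<inter> {..real n}) x = (indicator A x :: real)" if "n \<ge> N" for n
          using that by (auto split: split_indicator)
        then show "(\<lambda>n. indicator (A \<inter> {..real n}) x :: real) \<longlonglongrightarrow> indicator A x"
          by (intro tendsto_eventually) (auto simp: eventually_sequentially)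
      qed
    qed (use \<open>A \<in> sets borel\<close> in \<open>auto intro!: AE_I2 split: split_indicator\<close>)
    have "abs_L1 (indicator A) \<in> ?V"
      by (rule closed_sequentially[OF closed_closure _ *])
        (rule closure_L1_simple_indicator[OF \<open>A \<in> sets borel\<close>])
    then have "c *\<^sub>R abs_L1 (indicator A) \<in> ?V" by (rule closure_L1_simple_scaleR)
    moreover have "integrable half_line (indicator A :: real \<Rightarrow> real)"
      using base by (intro integrable_real_indicator) auto
    ultimately show ?case by (simp add: abs_L1_scaleR mult.commute)
  next
    case (add f g)
    then show ?case using closure_L1_simple_add by (simp add: abs_L1_plus[symmetric])
  next
    case (lim f s)
    have *: "(\<lambda>n. abs_L1 (s n)) \<longlonglongrightarrow> abs_L1 f"
      by (rule tendsto_abs_L1_dominated[where w = "\<lambda>x. 2 * \<bar>f x\<bar>"])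
        (use lim in \<open>auto intro!: AE_I2 borel_measurable_integrable\<close>)
    show ?case by (rule closed_sequentially[OF closed_closure _ *]) (rule lim)
  qed
  then have "F \<in> ?V" for F by (metis L1_cases)
  then show ?thesis by blast
qed

instance L1 :: second_countable_topology
proof
  let ?B = "(\<lambda>(xs, n). ball (L1_simple xs) (1 / real (Suc n))) ` UNIV"
  have "topological_basis ?B"
  proof (rule topological_basisI)
    fix U :: "L1 set" and f assume "open U" "f \<in> U"
    then obtain e where e: "e > 0" "ball f e \<subseteq> U" by (auto simp: open_contains_ball)
    obtain n where n: "1 / real (Suc n) < e / 2"
      using reals_Archimedean[of "e/2"] e(1) by (auto simp: inverse_eq_divide)
    have "f \<in> closure (range L1_simple)" by (simp add: dense_L1_simple)
    then obtain xs where xs: "dist (L1_simple xs) f < 1 / real (Suc n)"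
      unfolding closure_approachable by (metis rangeE of_nat_0_less_iff zero_less_Suc zero_less_divide_1_iff)
    have "ball (L1_simple xs) (1 / real (Suc n)) \<subseteq> ball f e"
    proof
      fix g assume "g \<in> ball (L1_simple xs) (1 / real (Suc n))"
      then have "dist f g < e"
        using xs n dist_triangle[of f g "L1_simple xs"] by (simp add: dist_commute)
      then show "g \<in> ball f e" by simp
    qed
    then show "\<exists>B\<in>?B. f \<in> B \<and> B \<subseteq> U"
      using xs e(2) by (intro bexI[of _ "ball (L1_simple xs) (1 / real (Suc n))"]) auto
  qed auto
  moreover have "countable ?B" by (intro countable_image) simp
  ultimately show "\<exists>B::L1 set set. countable B \<and> open = generate_topology B"
    using topological_basis_imp_subbasis by blast
qed


section \<open>Shift semigroup, subordination, generators\<close>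

definition zero_ext :: "(real \<Rightarrow> real) \<Rightarrow> real \<Rightarrow> real" where
  "zero_ext \<phi> x = (if 0 < x then \<phi> x else 0)"

lemma integrable_zero_ext_iff: "integrable lborel (zero_ext \<phi>) \<longleftrightarrow> integrable half_line \<phi>"
proof -
  have "zero_ext \<phi> = (\<lambda>x. indicator {0<..} x * \<phi> x)"
    by (auto simp: zero_ext_def split: split_indicator)
  then show ?thesis by (simp add: integrable_half_line_iff)
qed

lemma AE_zero_ext_iff:
  "(AE x in lborel. zero_ext \<phi> x = zero_ext \<psi> x) \<longleftrightarrow> (AE x in half_line. \<phi> x = \<psi> x)"
  unfolding half_line_def by (subst AE_restrict_space_iff) (auto simp: zero_ext_def intro!: AE_cong)

lemma AE_lborel_translate:
  fixes g h :: "real \<Rightarrow> real"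
  assumes [measurable]: "g \<in> borel_measurable borel" "h \<in> borel_measurable borel"
    and "AE x in lborel. g x = h x"
  shows "AE x in lborel. g (x - t) = h (x - t)"
proof -
  have "AE x in distr lborel borel ((+) (- t)). g x = h x"
    using assms(3) by (subst lborel_distr_plus)
  then show ?thesis
    by (subst (asm) AE_distr_iff) (auto simp: algebra_simps)
qed

text \<open>The shift is only used for \<^term>\<open>t \<ge> 0\<close>, where it is the right shift; at 0 it is the identity.\<close>

lift_definition shift_L1 :: "real \<Rightarrow> L1 \<Rightarrow> L1" is "\<lambda>t \<phi> x. zero_ext \<phi> (x - t)"
proof -
  fix t :: real and \<phi> \<psi> :: "real \<Rightarrow> real"
  assume A: "integrable half_line \<phi> \<and> integrable half_line \<psi> \<and> (AE x in half_line. \<phi> x = \<psi> x)"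
  have int: "integrable half_line (\<lambda>x. zero_ext \<eta> (x - t))" if "integrable half_line \<eta>" for \<eta>
  proof -
    have "integrable lborel (\<lambda>x. zero_ext \<eta> (- t + 1 * x))"
      using that by (intro lborel_integrable_real_affine) (auto simp: integrable_zero_ext_iff)
    then have "integrable lborel (\<lambda>x. zero_ext \<eta> (x - t))" by simp
    then show ?thesis
      unfolding integrable_half_line_iff
      using integrable_mult_indicator[of "{0<..}" lborel "\<lambda>x. zero_ext \<eta> (x - t)"] by simp
  qed
  have meas: "zero_ext \<eta> \<in> borel_measurable borel" if "integrable half_line \<eta>" for \<eta>
    using that borel_measurable_integrable[of lborel "zero_ext \<eta>"] by (simp add: integrable_zero_ext_iff)
  have "AE x in lborel. zero_ext \<phi> (x - t) = zero_ext \<psi> (x - t)"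
    using A by (intro AE_lborel_translate meas) (auto simp: AE_zero_ext_iff)
  then have "AE x in half_line. zero_ext \<phi> (x - t) = zero_ext \<psi> (x - t)"
    unfolding half_line_def by (subst AE_restrict_space_iff) (auto elim: eventually_mono)
  then show "integrable half_line (\<lambda>x. zero_ext \<phi> (x - t)) \<and> integrable half_line (\<lambda>x. zero_ext \<psi> (x - t)) \<and>
      (AE x in half_line. zero_ext \<phi> (x - t) = zero_ext \<psi> (x - t))"
    using A int by blast
qed

lemma shift_L1_0: "shift_L1 0 \<phi> = \<phi>"
proof transfer
  fix \<phi> :: "real \<Rightarrow> real"
  assume "integrable half_line \<phi> \<and> integrable half_line \<phi> \<and> (AE x in half_line. \<phi> x = \<phi> x)"
  moreover have "integrable half_line (\<lambda>x. zero_ext \<phi> (x - 0)) \<longleftrightarrow> integrable half_line \<phi>"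
    by (rule Bochner_Integration.integrable_cong) (auto simp: zero_ext_def)
  moreover have "AE x in half_line. zero_ext \<phi> (x - 0) = \<phi> x"
    by (rule AE_I2) (auto simp: zero_ext_def)
  ultimately show "integrable half_line (\<lambda>x. zero_ext \<phi> (x - 0)) \<and> integrable half_line \<phi> \<and>
      (AE x in half_line. zero_ext \<phi> (x - 0) = \<phi> x)"
    by blast
qed

text \<open>
  Almost surely finite (no killing) subordinators, that is, nondecreasing Levy processes
  started at 0.
\<close>

definition subordinator :: "'w measure \<Rightarrow> (real \<Rightarrow> 'w \<Rightarrow> real) \<Rightarrow> bool" where
  "subordinator P S \<longleftrightarrow>
     prob_space P \<and>
     (\<forall>t\<ge>0. S t \<in> borel_measurable P) \<and>
     (AE \<omega> in P. S 0 \<omega> = 0) \<and>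
     (\<forall>(t::nat \<Rightarrow> real) n. 0 \<le> t 0 \<and> mono t \<longrightarrow>
        prob_space.indep_vars P (\<lambda>_. borel) (\<lambda>i \<omega>. S (t (Suc i)) \<omega> - S (t i) \<omega>) {..<n}) \<and>
     (\<forall>s t. 0 \<le> s \<and> s \<le> t \<longrightarrow>
        distr P borel (\<lambda>\<omega>. S t \<omega> - S s \<omega>) = distr P borel (S (t - s))) \<and>
     (AE \<omega> in P. mono_on {0..} (\<lambda>t. S t \<omega>) \<and> (\<forall>t\<ge>0. continuous (at_right t) (\<lambda>s. S s \<omega>)))"

definition subordinate ::
  "'w measure \<Rightarrow> (real \<Rightarrow> 'w \<Rightarrow> real) \<Rightarrow>
    (real \<Rightarrow> 'a \<Rightarrow> 'a::{banach, second_countable_topology}) \<Rightarrow> real \<Rightarrow> 'a \<Rightarrow> 'a" where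
  "subordinate P S T t \<phi> = (LINT s:{0..}|distr P borel (S t). T s \<phi>)"

definition generator_domain :: "(real \<Rightarrow> 'a \<Rightarrow> 'a::real_normed_vector) \<Rightarrow> 'a set" where
  "generator_domain T = {\<phi>. \<exists>\<psi>. ((\<lambda>t. (T t \<phi> - \<phi>) /\<^sub>R t) \<longlongrightarrow> \<psi>) (at_right 0)}"

definition generator :: "(real \<Rightarrow> 'a \<Rightarrow> 'a::real_normed_vector) \<Rightarrow> 'a \<Rightarrow> 'a" where
  "generator T \<phi> = Lim (at_right 0) (\<lambda>t. (T t \<phi> - \<phi>) /\<^sub>R t)"

section \<open>Bernstein functions and the Bernstein-Riemann-Liouville derivative\<close>

definition bernstein_triplet :: "(real \<Rightarrow> real) \<Rightarrow> real \<Rightarrow> real \<Rightarrow> real measure \<Rightarrow> bool" where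
  "bernstein_triplet f a b \<mu> \<longleftrightarrow>
     0 \<le> a \<and> 0 \<le> b \<and> sets \<mu> = sets (restrict_space borel {0<..}) \<and>
     (\<integral>\<^sup>+ t. ennreal (min 1 t) \<partial>\<mu>) < \<infinity> \<and>
     (\<forall>x>0. f x = a + b * x + (\<integral>t. (1 - exp (- x * t)) \<partial>\<mu>))"

text \<open>
  The law with Laplace transform \<open>n / (n + f)\<close>. It lives on the closed half-line: for a finite
  measure \<open>\<mu>\<close> it has an atom at 0, which does not contribute to \<open>approx_derivative\<close>.
\<close>

definition approx_law :: "(real \<Rightarrow> real) \<Rightarrow> nat \<Rightarrow> real measure" where
  "approx_law f n = (THE \<rho>. prob_space \<rho> \<and> sets \<rho> = sets borel \<and> emeasure \<rho> {..<0} = 0 \<and>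
     (\<forall>x>0. (\<integral>t. exp (- x * t) \<partial>\<rho>) = real n / (real n + f x)))"

text \<open>
  The operator associated with \<open>n f / (n + f)\<close>. By Fubini, the class on the right does not
  depend on the representative. The index \<open>n = 0\<close> is irrelevant, since only the limit
  \<open>n \<rightarrow> \<infinity>\<close> is used.
\<close>

definition approx_derivative :: "(real \<Rightarrow> real) \<Rightarrow> nat \<Rightarrow> L1 \<Rightarrow> L1" where
  "approx_derivative f n \<phi> = abs_L1 (\<lambda>x. LINT t:{0<..}|approx_law f n.
     (zero_ext (rep_L1 \<phi>) x - zero_ext (rep_L1 \<phi>) (x - t)) * real n)"

definition BRL_domain :: "(real \<Rightarrow> real) \<Rightarrow> L1 set" where
  "BRL_domain f = {\<phi>. \<exists>\<psi>. (\<lambda>n. norm (approx_derivative f n \<phi> - \<psi>)) \<longlonglongrightarrow> 0}"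

definition BRL_derivative :: "(real \<Rightarrow> real) \<Rightarrow> L1 \<Rightarrow> L1" where
  "BRL_derivative f \<phi> = (THE \<psi>. (\<lambda>n. norm (approx_derivative f n \<phi> - \<psi>)) \<longlonglongrightarrow> 0)"

end

theory Submission
  imports Defs
begin

text \<open>
  Both domains consist of those \<open>\<phi>\<close> for which some \<open>\<psi>\<close> in \<open>L\<^sup>1\<close> has Laplace transform
  \<open>f\<close> times that of \<open>\<phi>\<close>, and both operators map \<open>\<phi>\<close> to this \<open>\<psi>\<close>. A limit in either
  definition has this property because Laplace transforms are continuous on \<open>L\<^sup>1\<close>. Conversely, write
  \<open>\<kappa> * \<psi>\<close> for the average of the shifts of \<open>\<psi>\<close> under a law \<open>\<kappa>\<close> on the half-line. Injectivity of the
  Laplace transform identifies the approximating derivative of \<open>\<phi>\<close> with \<open>\<rho>\<^sub>n * \<psi>\<close>, and the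
  difference quotient at time \<open>t\<close> of the subordinate semigroup with \<open>- \<kappa>\<^sub>t * \<psi>\<close>, where \<open>\<kappa>\<^sub>t\<close> is
  the law of the subordinator at an independent uniform time in \<open>[0, t]\<close>. These laws concentrate at 0, so
  the averages tend to \<open>\<psi>\<close>.
\<close>

section \<open>Uniqueness of Laplace transforms of finite measures\<close>

text \<open>Recovers the total mass from Laplace transforms at positive arguments only: dominated
  convergence along \<open>1 / Suc n\<close>, where nonnegativity of \<open>t\<close> gives the
  bound 1.\<close>

lemma integral_exp_limit_0:
  assumes "finite_measure M" and [measurable_cong]: "sets M = sets borel"
    and pos: "AE t in M. 0 \<le> (t::real)"
  shows "(\<lambda>n. \<integral>t. exp (- (1 / real (Suc n)) * t) \<partial>M) \<longlonglongrightarrow> measure M (space M)"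
proof -
  interpret finite_measure M by fact
  have "(\<lambda>n. \<integral>t. exp (- (1 / real (Suc n)) * t) \<partial>M) \<longlonglongrightarrow> (\<integral>t. 1 \<partial>M)"
  proof (rule integral_dominated_convergence[where w = "\<lambda>_. 1"])
    show "AE t in M. (\<lambda>n. exp (- (1 / real (Suc n)) * t)) \<longlonglongrightarrow> 1"
    proof (rule AE_I2)
      fix t :: real
      have "(\<lambda>n. exp (- (1 / real (Suc n)) * t)) \<longlonglongrightarrow> exp (- 0 * t)"
        using LIMSEQ_inverse_real_of_nat by (intro tendsto_intros) (simp add: inverse_eq_divide)
      then show "(\<lambda>n. exp (- (1 / real (Suc n)) * t)) \<longlonglongrightarrow> 1" by simp
    qed
    show "AE t in M. norm (exp (- (1 / real (Suc n)) * t)) \<le> 1" for n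
      using pos by eventually_elim simp
  qed simp_all
  then show ?thesis by simp
qed

text \<open>Under \<open>y = exp (- t)\<close> the half-line becomes a subset of
  \<open>{0..1}\<close> and the Laplace transforms at natural numbers become moments. Equal moments
  give equal integrals of polynomials, and Weierstrass approximation on \<open>{0..1}\<close> passes
  to continuous \<open>g\<close>.\<close>

lemma integral_comp_exp_eq:
  fixes g :: "real \<Rightarrow> real"
  assumes M: "finite_measure M" "sets M = sets borel" "AE t in M. 0 \<le> (t::real)"
    and N: "finite_measure N" "sets N = sets borel" "AE t in N. 0 \<le> (t::real)"
    and eq: "\<And>x. 0 < x \<Longrightarrow> (\<integral>t. exp (- x * t) \<partial>M) = (\<integral>t. exp (- x * t) \<partial>N)"
    and g: "continuous_on UNIV g"
  shows "(\<integral>t. g (exp (- t)) \<partial>M) = (\<integral>t. g (exp (- t)) \<partial>N)"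
proof -
  have [measurable]: "g \<in> borel_measurable borel" 
    using g by (rule borel_measurable_continuous_onI)
  have mass: "measure M (space M) = measure N (space N)"
  proof (rule LIMSEQ_unique)
    show "(\<lambda>n. \<integral>t. exp (- (1 / real (Suc n)) * t) \<partial>N) \<longlonglongrightarrow> measure M (space M)"
      using integral_exp_limit_0[OF M] by (subst eq[symmetric]) auto
  qed (rule integral_exp_limit_0[OF N])
  have int: "integrable L (\<lambda>t. h (exp (- t)))"
    if L: "finite_measure L" "sets L = sets borel" "AE t in L. 0 \<le> t" and h: "continuous_on UNIV h"
    for L and h :: "real \<Rightarrow> real"
  proof -
    note [measurable_cong] = L(2)
    have [measurable]: "h \<in> borel_measurable borel"
      using h by (rule borel_measurable_continuous_onI)
    have "bounded (h ` {0..1})"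
      using h by (intro compact_imp_bounded compact_continuous_image) (auto intro: continuous_on_subset)
    then obtain B where B: "\<And>y. y \<in> {0..1} \<Longrightarrow> norm (h y) \<le> B"
      unfolding bounded_iff by blast
    show ?thesis
    proof (rule finite_measure.integrable_const_bound[OF L(1), of _ B])
      show "AE t in L. norm (h (exp (- t))) \<le> B"
        using L(3) by eventually_elim (intro B, simp)
    qed simp
  qed
  \<comment> \<open>The hypothesis covers only positive arguments, so the moment of order 0 is taken
    from \<open>mass\<close>.\<close>
  have mom: "(\<integral>t. exp (- t) ^ k \<partial>M) = (\<integral>t. exp (- t) ^ k \<partial>N)" for k
  proof (cases "k = 0")
    case True
    then show ?thesis using mass by simp
  next
    case False
    have "exp (- t) ^ k = exp (- real k * t)" for t
      by (simp add: exp_of_nat_mult[symmetric])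
    then show ?thesis using eq[of "real k"] False by simp
  qed
  have poly: "(\<integral>t. p (exp (- t)) \<partial>M) = (\<integral>t. p (exp (- t)) \<partial>N)"
    if rp: "real_polynomial_function p" for p
  proof -
    obtain a n where p: "p = (\<lambda>x. \<Sum>i\<le>n. a i * x ^ i)"
      using real_polynomial_function_imp_sum[OF rp] by auto
    have "integrable L (\<lambda>t. exp (- t) ^ i)"
      if "finite_measure L" "sets L = sets borel" "AE t in L. 0 \<le> (t::real)" for L i
      using int[OF that, of "\<lambda>y. y ^ i"] by (simp add: continuous_intros)
    note pow_int = this
    have "(\<integral>t. p (exp (- t)) \<partial>L) = (\<Sum>i\<le>n. a i * (\<integral>t. exp (- t) ^ i \<partial>L))"
      if "finite_measure L" "sets L = sets borel" "AE t in L. 0 \<le> (t::real)" for L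
      unfolding p by (subst Bochner_Integration.integral_sum) (auto intro!: integrable_mult_right pow_int that)
    then show ?thesis
      using M N by (simp only: mom)
  qed
  have approx: "\<exists>p. real_polynomial_function p \<and> (\<forall>y\<in>{0..1}. \<bar>g y - p y\<bar> < e)" if "e > 0" for e
  proof -
    have "continuous_on {0..1} g" using g by (rule continuous_on_subset) simp
    from Stone_Weierstrass_real_polynomial_function[OF compact_Icc this that] obtain p
      where "real_polynomial_function p" "\<And>y. y \<in> {0..1} \<Longrightarrow> \<bar>g y - p y\<bar> < e"
      by metis
    then show ?thesis by blast
  qed
  have close: "\<bar>(\<integral>t. g (exp (- t)) \<partial>L) - (\<integral>t. p (exp (- t)) \<partial>L)\<bar> \<le> e * measure L (space L)"
    if L: "finite_measure L" "sets L = sets borel" "AE t in L. 0 \<le> t"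
      and p: "real_polynomial_function p" "\<forall>y\<in>{0..1}. \<bar>g y - p y\<bar> < e" for L p e
  proof -
    have pc: "continuous_on UNIV p"
      using p(1) by (simp add: continuous_on_polymonial_function real_polynomial_function_eq)
    have i: "integrable L (\<lambda>t. g (exp (- t)))" "integrable L (\<lambda>t. p (exp (- t)))"
      using int[OF L] g pc by auto
    have "\<bar>(\<integral>t. g (exp (- t)) \<partial>L) - (\<integral>t. p (exp (- t)) \<partial>L)\<bar> = \<bar>\<integral>t. g (exp (- t)) - p (exp (- t)) \<partial>L\<bar>"
      using i by simp
    also have "\<dots> \<le> (\<integral>t. \<bar>g (exp (- t)) - p (exp (- t))\<bar> \<partial>L)"
      by (rule integral_abs_bound)
    also have "\<dots> \<le> (\<integral>t. e \<partial>L)"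
    proof (rule integral_mono_AE)
      show "AE t in L. \<bar>g (exp (- t)) - p (exp (- t))\<bar> \<le> e"
        using L(3) p(2) by (auto intro!: less_imp_le)
    qed (use i L(1) in \<open>auto simp: finite_measure.integrable_const\<close>)
    finally show ?thesis by (simp add: mult.commute)
  qed
  \<comment> \<open>A common bound for both total masses, by which the tolerance is divided. The
    summand 1 keeps it positive even if both measures vanish.\<close>
  define m where "m = measure M (space M) + measure N (space N) + 1"
  have m: "m > 0" by (simp add: m_def add_nonneg_pos)
  have "\<bar>(\<integral>t. g (exp (- t)) \<partial>M) - (\<integral>t. g (exp (- t)) \<partial>N)\<bar> \<le> e" if "e > 0" for e
  proof -
    have "e / m > 0" using that m by simp
    from approx[OF this] obtain p where
      p: "real_polynomial_function p" "\<forall>y\<in>{0..1}. \<bar>g y - p y\<bar> < e / m" by blast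
    have "\<bar>(\<integral>t. g (exp (- t)) \<partial>M) - (\<integral>t. g (exp (- t)) \<partial>N)\<bar>
      \<le> e / m * measure M (space M) + e / m * measure N (space N)"
      using close[OF M p] close[OF N p] poly[OF p(1)] by linarith
    also have "\<dots> \<le> e / m * m"
      using \<open>e / m > 0\<close> unfolding m_def by (simp add: distrib_left)
    finally show ?thesis using m by simp
  qed
  then have "\<bar>(\<integral>t. g (exp (- t)) \<partial>M) - (\<integral>t. g (exp (- t)) \<partial>N)\<bar> \<le> 0"
    by (rule field_le_epsilon) simp
  then show ?thesis by simp
qed

text \<open>A finite measure on the line is determined by its tails \<open>{c<..}\<close>, and the
  indicator of a tail is a pointwise limit of continuous functions of \<open>exp (- t)\<close>, to
  which \<open>integral_comp_exp_eq\<close> applies.\<close>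

lemma laplace_transform_unique:
  fixes M N :: "real measure"
  assumes M: "finite_measure M" "sets M = sets borel" "AE t in M. 0 \<le> t"
    and N: "finite_measure N" "sets N = sets borel" "AE t in N. 0 \<le> t"
    and eq: "\<And>x. 0 < x \<Longrightarrow> (\<integral>t. exp (- x * t) \<partial>M) = (\<integral>t. exp (- x * t) \<partial>N)"
  shows "M = N"
proof (rule measure_eqI_lessThan)
  fix c :: real
  \<comment> \<open>\<open>cts_step a b\<close> is 1 up to \<open>a\<close>, 0 from \<open>b\<close>
    on, and linear in between. Since \<open>c < t\<close> means
    \<open>exp (- t) < exp (- c)\<close>, the ramp must end exactly at \<open>exp (- c)\<close>:
    then \<open>s n (exp (- t))\<close> is 0 for all \<open>t \<le> c\<close>, and it is eventually
    1 for each \<open>t > c\<close>.\<close>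
  define s where "s n = cts_step (exp (- c) - 1 / real (Suc n)) (exp (- c))" for n
  have s: "continuous_on UNIV (s n)" for n
    unfolding s_def by (intro uniformly_continuous_imp_continuous cts_step_uniformly_continuous) simp
  have [measurable]: "s n \<in> borel_measurable borel" for n
    using s by (rule borel_measurable_continuous_onI)
  have lim: "(\<lambda>n. \<integral>t. s n (exp (- t)) \<partial>L) \<longlonglongrightarrow> measure L {c<..}"
    if L: "finite_measure L" "sets L = sets borel" for L
  proof -
    interpret finite_measure L by fact
    note [measurable_cong] = L(2)
    have "(\<lambda>n. \<integral>t. s n (exp (- t)) \<partial>L) \<longlonglongrightarrow> (\<integral>t. indicator {c<..} t \<partial>L)"
    proof (rule integral_dominated_convergence[where w = "\<lambda>_. 1"])
      show "AE t in L. (\<lambda>n. s n (exp (- t))) \<longlonglongrightarrow> indicator {c<..} t"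
      proof (rule AE_I2)
        fix t :: real
        show "(\<lambda>n. s n (exp (- t))) \<longlonglongrightarrow> indicator {c<..} t"
        proof (cases "c < t")
          case True
          then have "0 < exp (- c) - exp (- t)" by simp
          then obtain n0 where n0: "inverse (real (Suc n0)) < exp (- c) - exp (- t)"
            using reals_Archimedean by blast
          have "s n (exp (- t)) = 1" if "n \<ge> n0" for n
          proof -
            have "1 / real (Suc n) \<le> 1 / real (Suc n0)"
              using that by (intro divide_left_mono) auto
            then show ?thesis
              using n0 unfolding s_def cts_step_def inverse_eq_divide by simp
          qed
          then show ?thesis using True
            by (intro tendsto_eventually) (auto simp: eventually_sequentially)
        next
          case False
          then have "s n (exp (- t)) = 0" for n
            using exp_le_cancel_iff[of "- c" "- t"] unfolding s_def cts_step_def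
            by (smt (verit) of_nat_0_less_iff zero_less_Suc zero_less_divide_1_iff)
          then show ?thesis using False by simp
        qed
      qed
      show "AE t in L. norm (s n (exp (- t))) \<le> 1" for n
      proof (rule AE_I2)
        fix t :: real
        have "0 \<le> s n y \<and> s n y \<le> 1" for y
        proof (cases "y \<le> exp (- c) - 1 / real (Suc n) \<or> exp (- c) \<le> y")
          case False
          then have "0 \<le> exp (- c) - y" "exp (- c) - y \<le> 1 / real (Suc n)" by auto
          then have "0 \<le> (exp (- c) - y) * real (Suc n)" "(exp (- c) - y) * real (Suc n) \<le> 1"
            by (auto simp: pos_le_divide_eq simp del: of_nat_Suc)
          then show ?thesis using False by (simp add: s_def cts_step_def)
        qed (auto simp: s_def cts_step_def)
        then show "norm (s n (exp (- t))) \<le> 1" by simp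
      qed
    qed simp_all
    then show ?thesis using L(2) by (simp add: sets_eq_imp_space_eq[OF L(2)])
  qed
  have "measure M {c<..} = measure N {c<..}"
  proof (rule LIMSEQ_unique)
    show "(\<lambda>n. \<integral>t. s n (exp (- t)) \<partial>N) \<longlonglongrightarrow> measure M {c<..}"
      using lim[OF M(1,2)] integral_comp_exp_eq[OF M N eq s] by simp
  qed (rule lim[OF N(1,2)])
  then show "emeasure M {c<..} = emeasure N {c<..}"
    using M(1) N(1) by (simp add: finite_measure.emeasure_eq_measure)
  show "emeasure M {c<..} < \<infinity>"
    using M(1) by (simp add: finite_measure.emeasure_eq_measure)
qed fact+

section \<open>Shifts and Laplace transforms on the half-line\<close>

lemma integral_half_line:
  fixes g :: "real \<Rightarrow> real"
  shows "(\<integral>x. g x \<partial>half_line) = (\<integral>x. indicator {0<..} x * g x \<partial>lborel)"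
  unfolding half_line_def by (subst integral_restrict_space) auto

lemma zero_ext_measurable:
  "integrable half_line g \<Longrightarrow> zero_ext g \<in> borel_measurable borel"
  using borel_measurable_integrable[of lborel "zero_ext g"] by (simp add: integrable_zero_ext_iff)

lemma integral_half_line_zero_ext:
  "(\<integral>x. h x * g x \<partial>half_line) = (\<integral>x. h x * zero_ext g x \<partial>lborel)" for g h :: "real \<Rightarrow> real"
  unfolding integral_half_line zero_ext_def
  by (rule Bochner_Integration.integral_cong) (auto split: split_indicator)

lemma integral_half_line_abs_zero_ext:
  "(\<integral>x. \<bar>g x\<bar> \<partial>half_line) = (\<integral>x. \<bar>zero_ext g x\<bar> \<partial>lborel)" for g :: "real \<Rightarrow> real"
  unfolding integral_half_line zero_ext_def
  by (rule Bochner_Integration.integral_cong) (auto split: split_indicator)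

text \<open>A shift to the right already vanishes on the nonpositive axis. Integrals of shifts over
  the half-line therefore turn into integrals over the whole line, where translation invariance is
  available.\<close>

lemma zero_ext_shift:
  "0 \<le> s \<Longrightarrow> zero_ext (\<lambda>x. zero_ext g (x - s)) x = zero_ext g (x - s)"
  by (auto simp: zero_ext_def)

lemma integrable_shift:
  "integrable lborel (\<lambda>x. h (x - s)) \<longleftrightarrow> integrable lborel h" for h :: "real \<Rightarrow> real"
  using lborel_integrable_real_affine_iff[of 1 h "- s"] by simp

lemma integral_shift:
  "(\<integral>x. h (x - s) \<partial>lborel) = (\<integral>x. h x \<partial>lborel)" for h :: "real \<Rightarrow> real"
  using lborel_integral_real_affine[of 1 h "- s"] by simp

lemma integrable_half_line_shift:
  assumes "0 \<le> s" "integrable half_line g"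
  shows "integrable half_line (\<lambda>x. zero_ext g (x - s))"
  using assms by (simp add: integrable_zero_ext_iff[symmetric] zero_ext_shift integrable_shift cong: Bochner_Integration.integrable_cong)

lemma shift_L1_abs: "integrable half_line g \<Longrightarrow> shift_L1 s (abs_L1 g) = abs_L1 (\<lambda>x. zero_ext g (x - s))"
  by (rule shift_L1.abs_eq) auto

lemma norm_shift_L1: "0 \<le> s \<Longrightarrow> norm (shift_L1 s \<phi>) = norm \<phi>"
proof (cases \<phi> rule: L1_cases)
  case (1 g)
  assume s: "0 \<le> s"
  show ?thesis
    using 1 s integrable_half_line_shift[OF s, of g]
    by (simp add: shift_L1_abs norm_abs_L1 integral_half_line_abs_zero_ext zero_ext_shift
      integral_shift[of "\<lambda>x. \<bar>zero_ext g x\<bar>"])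
qed

lemma shift_L1_add: "0 \<le> s \<Longrightarrow> shift_L1 s (\<phi> + \<psi>) = shift_L1 s \<phi> + shift_L1 s \<psi>"
proof (cases \<phi> rule: L1_cases; cases \<psi> rule: L1_cases)
  fix g h assume A: "0 \<le> s" "integrable half_line g" "\<phi> = abs_L1 g" "integrable half_line h" "\<psi> = abs_L1 h"
  have "zero_ext (\<lambda>x. g x + h x) = (\<lambda>x. zero_ext g x + zero_ext h x)"
    by (auto simp: zero_ext_def)
  then show ?thesis using A by (simp add: abs_L1_plus shift_L1_abs integrable_half_line_shift)
qed

lemma shift_L1_scaleR: "0 \<le> s \<Longrightarrow> shift_L1 s (c *\<^sub>R \<phi>) = c *\<^sub>R shift_L1 s \<phi>"
proof (cases \<phi> rule: L1_cases)
  fix g assume A: "0 \<le> s" "integrable half_line g" "\<phi> = abs_L1 g"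
  have "zero_ext (\<lambda>x. c * g x) = (\<lambda>x. c * zero_ext g x)"
    by (auto simp: zero_ext_def)
  then show ?thesis using A by (simp add: abs_L1_scaleR shift_L1_abs integrable_half_line_shift)
qed

lemma bounded_linear_shift_L1: "0 \<le> s \<Longrightarrow> bounded_linear (shift_L1 s)"
  by (rule bounded_linear_intro[of _ 1]) (auto simp: shift_L1_add shift_L1_scaleR norm_shift_L1)

section \<open>Strong continuity of the shifts on \<open>L1\<close>\<close>

lemma continuous_on_shift_L1_step: "continuous_on {0..} (\<lambda>s. shift_L1 s (L1_step q))"
  unfolding continuous_on_sequentially
proof (intro ballI allI impI, elim conjE)
  fix s :: real and u :: "nat \<Rightarrow> real"
  assume s: "s \<in> {0..}" and u: "\<forall>n. u n \<in> {0..}" "u \<longlonglongrightarrow> s"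
  let ?g = "zero_ext (indicator {..q})"
  \<comment> \<open>A convergent sequence of shift lengths is bounded. All shifted steps then live
    below \<open>q + K\<close>, which gives an integrable dominating function on the
    half-line.\<close>
  obtain K where K: "\<And>n. \<bar>u n\<bar> \<le> K"
    using convergent_imp_Bseq[of u] u(2) unfolding convergent_def Bseq_def by (auto simp: less_imp_le)
  have [measurable]: "?g \<in> borel_measurable borel" by (rule zero_ext_measurable) simp
  have "(\<lambda>n. abs_L1 (\<lambda>x. ?g (x - u n))) \<longlonglongrightarrow> abs_L1 (\<lambda>x. ?g (x - s))"
  proof (rule tendsto_abs_L1_dominated[where w = "indicator {..q + K}"])
    show "AE x in half_line. (\<lambda>n. ?g (x - u n)) \<longlonglongrightarrow> ?g (x - s)"
    proof -
      \<comment> \<open>The two jump points of the step shifted by \<open>s\<close>. Away from them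
        the shifted steps at \<open>x\<close> eventually agree with the limit.\<close>
      have "AE x in lborel. x \<noteq> s \<and> x \<noteq> s + q"
        using AE_lborel_singleton[of s] AE_lborel_singleton[of "s + q"] by auto
      then have "AE x in half_line. x \<noteq> s \<and> x \<noteq> s + q"
        unfolding half_line_def by (subst AE_restrict_space_iff) (auto elim: eventually_mono)
      then show ?thesis
      proof eventually_elim
        case (elim x)
        have lim: "(\<lambda>n. x - u n) \<longlonglongrightarrow> x - s" by (intro tendsto_intros u)
        have "\<forall>\<^sub>F n in sequentially. (0 < x - u n \<longleftrightarrow> 0 < x - s)"
        proof (cases "0 < x - s")
          case True
          then show ?thesis using order_tendstoD(1)[OF lim True] by (auto elim: eventually_mono)
        next
          case False
          then have "x - s < 0" using elim by simp
          from order_tendstoD(2)[OF lim this] show ?thesis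
            using False by (auto elim: eventually_mono)
        qed
        moreover have "\<forall>\<^sub>F n in sequentially. (x - u n \<le> q \<longleftrightarrow> x - s \<le> q)"
        proof (cases "x - s < q")
          case True
          then show ?thesis using order_tendstoD(2)[OF lim True] by (auto elim: eventually_mono)
        next
          case False
          then have "q < x - s" using elim by auto
          from order_tendstoD(1)[OF lim this] show ?thesis
            using False \<open>q < x - s\<close> by (auto elim!: eventually_mono)
        qed
        ultimately have "\<forall>\<^sub>F n in sequentially. ?g (x - u n) = ?g (x - s)"
          by eventually_elim (auto simp: zero_ext_def indicator_def)
        then show ?case by (rule tendsto_eventually)
      qed
    qed
    show "AE x in half_line. \<bar>?g (x - u n)\<bar> \<le> indicator {..q + K} x" for n
      using K[of n] by (auto simp: zero_ext_def split: split_indicator)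
  qed auto
  then show "((\<lambda>s. shift_L1 s (L1_step q)) \<circ> u) \<longlonglongrightarrow> shift_L1 s (L1_step q)"
    by (simp add: L1_step_def shift_L1_abs comp_def)
qed

text \<open>The shifts are isometries, so convergence of \<open>x n\<close> in norm makes the orbits
  converge uniformly in \<open>s\<close>. Hence the vectors with continuous orbit form a closed set,
  and this set contains the dense range of \<open>L1_simple\<close>.\<close>

lemma continuous_on_shift_L1: "continuous_on {0..} (\<lambda>s. shift_L1 s \<phi>)"
proof -
  let ?C = "{\<phi>. continuous_on {0..} (\<lambda>s. shift_L1 s \<phi>)}"
  have "closed ?C"
  proof (rule closed_sequential_limits[THEN iffD2], intro allI impI, elim conjE)
    fix x l assume x: "\<forall>n. x n \<in> ?C" "x \<longlonglongrightarrow> l"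
    have "uniform_limit {0..} (\<lambda>n s. shift_L1 s (x n)) (\<lambda>s. shift_L1 s l) sequentially"
    proof (rule uniform_limitI)
      fix e :: real assume "0 < e"
      then have "\<forall>\<^sub>F n in sequentially. dist (x n) l < e"
        using x(2) by (rule tendstoD[rotated])
      then show "\<forall>\<^sub>F n in sequentially. \<forall>s\<in>{0..}. dist (shift_L1 s (x n)) (shift_L1 s l) < e"
      proof eventually_elim
        case (elim n)
        have "dist (shift_L1 s (x n)) (shift_L1 s l) = dist (x n) l" if "0 \<le> s" for s
          using linear_diff[OF bounded_linear.linear[OF bounded_linear_shift_L1[OF that]], of "x n" l]
            norm_shift_L1[OF that, of "x n - l"] by (simp add: dist_norm)
        then show ?case using elim by simp
      qed
    qed
    then show "l \<in> ?C"
      using x(1) by (auto intro!: uniform_limit_theorem)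
  qed
  moreover have "range L1_simple \<subseteq> ?C"
  proof safe
    fix xs show "continuous_on {0..} (\<lambda>s. shift_L1 s (L1_simple xs))"
    proof (induction xs)
      case Nil
      have "norm (shift_L1 s 0) = 0" if "0 \<le> s" for s using norm_shift_L1[OF that, of 0] by simp
      then have "continuous_on {0..} (\<lambda>s. shift_L1 s 0) = continuous_on {0..} (\<lambda>s::real. 0 :: L1)"
        by (intro continuous_on_cong) auto
      then show ?case by (simp add: L1_simple_def)
    next
      case (Cons a xs)
      obtain c q where a: "a = (c, q)" by force
      have "continuous_on {0..} (\<lambda>s. of_rat c *\<^sub>R shift_L1 s (L1_step (of_rat q)) + shift_L1 s (L1_simple xs))"
        by (intro continuous_intros continuous_on_shift_L1_step Cons)
      also have "?this \<longleftrightarrow> ?case"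
        unfolding a by (intro continuous_on_cong) (auto simp: L1_simple_def shift_L1_add shift_L1_scaleR)
      finally show ?case .
    qed
  qed
  ultimately have "closure (range L1_simple) \<subseteq> ?C" by (rule closure_minimal[rotated])
  then show ?thesis by (auto simp: dense_L1_simple)
qed

section \<open>The Laplace transform on \<open>L1\<close>\<close>

lift_definition laplace_L1 :: "real \<Rightarrow> L1 \<Rightarrow> real" is "\<lambda>z \<phi>. \<integral>x. exp (- z * x) * \<phi> x \<partial>half_line"
  by (rule integral_cong_AE) (auto elim: eventually_mono)

lemma laplace_L1_abs:
  "integrable half_line g \<Longrightarrow> laplace_L1 z (abs_L1 g) = (\<integral>x. exp (- z * x) * g x \<partial>half_line)"
  by (rule laplace_L1.abs_eq) auto

lemma integrable_exp_mult:
  assumes "0 \<le> z" "integrable half_line g"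
  shows "integrable half_line (\<lambda>x. exp (- z * x) * g x)"
proof (rule Bochner_Integration.integrable_bound[OF assms(2)])
  show "AE x in half_line. norm (exp (- z * x) * g x) \<le> norm (g x)"
    using assms(1) by (intro AE_I2) (auto simp: abs_mult intro!: mult_left_le_one_le)
qed (use assms(2) in auto)

lemma bounded_linear_laplace_L1:
  assumes z: "0 \<le> z"
  shows "bounded_linear (laplace_L1 z)"
proof (rule bounded_linear_intro[of _ 1])
  fix \<phi> \<psi> :: L1 and c :: real
  obtain g where g: "integrable half_line g" "\<phi> = abs_L1 g" by (rule L1_cases)
  obtain h where h: "integrable half_line h" "\<psi> = abs_L1 h" by (rule L1_cases)
  note i = integrable_exp_mult[OF z g(1)] integrable_exp_mult[OF z h(1)]
  show "laplace_L1 z (\<phi> + \<psi>) = laplace_L1 z \<phi> + laplace_L1 z \<psi>"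
    using g h i by (simp add: abs_L1_plus laplace_L1_abs distrib_left)
  have "laplace_L1 z (c *\<^sub>R \<phi>) = (\<integral>x. c * (exp (- z * x) * g x) \<partial>half_line)"
    using g by (simp add: abs_L1_scaleR laplace_L1_abs mult.left_commute)
  then show "laplace_L1 z (c *\<^sub>R \<phi>) = c *\<^sub>R laplace_L1 z \<phi>"
    using g by (simp add: laplace_L1_abs)
  have "\<bar>\<integral>x. exp (- z * x) * g x \<partial>half_line\<bar> \<le> (\<integral>x. \<bar>exp (- z * x) * g x\<bar> \<partial>half_line)"
    by (rule integral_abs_bound)
  also have "\<dots> \<le> (\<integral>x. \<bar>g x\<bar> \<partial>half_line)"
  proof (rule integral_mono)
    show "integrable half_line (\<lambda>x. \<bar>exp (- z * x) * g x\<bar>)" using i(1) by (rule integrable_abs)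
    show "integrable half_line (\<lambda>x. \<bar>g x\<bar>)" using g(1) by (rule integrable_abs)
    show "\<bar>exp (- z * x) * g x\<bar> \<le> \<bar>g x\<bar>" if "x \<in> space half_line" for x
      using z that by (auto simp: abs_mult intro!: mult_left_le_one_le)
  qed
  finally show "norm (laplace_L1 z \<phi>) \<le> norm \<phi> * 1"
    using g by (simp add: laplace_L1_abs norm_abs_L1)
qed

lemma laplace_L1_shift:
  assumes "0 \<le> s"
  shows "laplace_L1 z (shift_L1 s \<phi>) = exp (- z * s) * laplace_L1 z \<phi>"
proof -
  obtain g where g: "integrable half_line g" "\<phi> = abs_L1 g" by (rule L1_cases)
  have "laplace_L1 z (shift_L1 s \<phi>) = (\<integral>x. exp (- z * x) * zero_ext g (x - s) \<partial>lborel)"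
    using assms g by (simp add: shift_L1_abs laplace_L1_abs integrable_half_line_shift
      integral_half_line_zero_ext zero_ext_shift)
  also have "\<dots> = (\<integral>x. exp (- z * (x - s)) * (exp (- z * s) * zero_ext g (x - s)) \<partial>lborel)"
    by (intro Bochner_Integration.integral_cong) (auto simp: exp_add[symmetric] algebra_simps)
  also have "\<dots> = (\<integral>x. exp (- z * s) * (exp (- z * x) * zero_ext g x) \<partial>lborel)"
    using integral_shift[of "\<lambda>x. exp (- z * x) * (exp (- z * s) * zero_ext g x)" s] by (simp add: mult.left_commute)
  finally show ?thesis
    using g by (simp add: laplace_L1_abs integral_half_line_zero_ext)
qed

text \<open>The positive and negative parts of the zero extension of \<open>\<phi> - \<psi>\<close>
  are densities of two finite measures on the half-line with the same Laplace transform, so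
  \<open>laplace_transform_unique\<close> makes them equal.\<close>

lemma laplace_L1_inj:
  assumes eq: "\<And>z. 0 < z \<Longrightarrow> laplace_L1 z \<phi> = laplace_L1 z \<psi>"
  shows "\<phi> = \<psi>"
proof -
  obtain g where g: "integrable half_line g" "\<phi> - \<psi> = abs_L1 g" by (rule L1_cases)
  have [measurable]: "zero_ext g \<in> borel_measurable borel" using g(1) by (rule zero_ext_measurable)
  define p where "p x = max 0 (zero_ext g x)" for x
  define m where "m x = max 0 (- zero_ext g x)" for x
  have [measurable]: "p \<in> borel_measurable borel" "m \<in> borel_measurable borel"
    unfolding p_def m_def by measurable
  have int: "integrable lborel p" "integrable lborel m"
    using g(1) unfolding p_def m_def by (auto simp: integrable_zero_ext_iff[symmetric])
  have nonneg: "0 \<le> p x" "0 \<le> m x" for x by (simp_all add: p_def m_def)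
  have fin: "finite_measure (density lborel (\<lambda>x. ennreal (q x)))"
    if "integrable lborel q" "\<And>x. 0 \<le> q x" for q :: "real \<Rightarrow> real"
    using that by (intro finite_measureI)
      (simp add: emeasure_density nn_integral_eq_integral)
  have pos: "AE t in density lborel (\<lambda>x. ennreal (q x)). 0 \<le> t"
    if [measurable]: "q \<in> borel_measurable borel" and "\<And>x. x \<le> 0 \<Longrightarrow> q x = 0" for q :: "real \<Rightarrow> real"
    using that(2) by (subst AE_density) (auto intro!: AE_I2, metis less_eq_real_def linorder_le_less_linear order_less_irrefl)
  have "density lborel (\<lambda>x. ennreal (p x)) = density lborel (\<lambda>x. ennreal (m x))"
  proof (rule laplace_transform_unique)
    fix z :: real assume z: "0 < z"
    have "laplace_L1 z (\<phi> - \<psi>) = 0"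
      using eq[OF z] linear_diff[OF bounded_linear.linear[OF bounded_linear_laplace_L1], of z \<phi> \<psi>] z by simp
    then have 0: "(\<integral>x. exp (- z * x) * zero_ext g x \<partial>lborel) = 0"
      using g by (simp add: laplace_L1_abs integral_half_line_zero_ext)
    have i: "integrable lborel (\<lambda>x. exp (- z * x) * q x)"
      if "integrable lborel q" "\<And>x. x \<le> 0 \<Longrightarrow> q x = 0" for q :: "real \<Rightarrow> real"
    proof (rule Bochner_Integration.integrable_bound[OF that(1)])
      have "exp (- z * x) * \<bar>q x\<bar> \<le> \<bar>q x\<bar>" for x
        using z that(2)[of x] by (cases "x \<le> 0") (auto intro!: mult_left_le_one_le)
      then show "AE x in lborel. norm (exp (- z * x) * q x) \<le> norm (q x)"
        by (simp add: abs_mult)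
    qed (use that in auto)
    have "(\<integral>x. exp (- z * x) * p x \<partial>lborel) - (\<integral>x. exp (- z * x) * m x \<partial>lborel)
        = (\<integral>x. exp (- z * x) * p x - exp (- z * x) * m x \<partial>lborel)"
      by (intro Bochner_Integration.integral_diff[symmetric] i int) (auto simp: p_def m_def zero_ext_def)
    also have "\<dots> = (\<integral>x. exp (- z * x) * zero_ext g x \<partial>lborel)"
      by (intro Bochner_Integration.integral_cong) (auto simp: p_def m_def max_def)
    finally have "(\<integral>x. exp (- z * x) * p x \<partial>lborel) = (\<integral>x. exp (- z * x) * m x \<partial>lborel)"
      using 0 by simp
    then show "(\<integral>t. exp (- z * t) \<partial>density lborel (\<lambda>x. ennreal (p x))) = (\<integral>t. exp (- z * t) \<partial>density lborel (\<lambda>x. ennreal (m x)))"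
      by (subst (1 2) integral_density) (auto simp: p_def m_def mult.commute)
  next
    show "finite_measure (density lborel (\<lambda>x. ennreal (p x)))" "finite_measure (density lborel (\<lambda>x. ennreal (m x)))"
      using fin int nonneg by blast+
    show "AE t in density lborel (\<lambda>x. ennreal (p x)). 0 \<le> t" "AE t in density lborel (\<lambda>x. ennreal (m x)). 0 \<le> t"
      by (rule pos, measurable, simp add: p_def m_def zero_ext_def)+
  qed auto
  then have "AE x in lborel. ennreal (p x) = ennreal (m x)"
    by (subst (asm) sigma_finite_density_unique) (auto intro!: finite_measure.sigma_finite_measure fin int nonneg)
  \<comment> \<open>At most one of \<open>p x\<close> and \<open>m x\<close> is nonzero, so equality
    forces both to vanish.\<close>
  then have "AE x in lborel. zero_ext g x = zero_ext (\<lambda>_. 0) x"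
    by eventually_elim (auto simp: p_def m_def zero_ext_def max_def split: if_splits)
  then have "abs_L1 g = 0"
    unfolding AE_zero_ext_iff zero_L1_def using g by (subst abs_L1_eq_iff) auto
  then show ?thesis using g by simp
qed

lemma laplace_L1_diff: "0 < z \<Longrightarrow> laplace_L1 z (\<phi> - \<psi>) = laplace_L1 z \<phi> - laplace_L1 z \<psi>"
  by (simp add: linear_diff[OF bounded_linear.linear[OF bounded_linear_laplace_L1]])

lemma laplace_L1_minus: "0 < z \<Longrightarrow> laplace_L1 z (- \<phi>) = - laplace_L1 z \<phi>"
  by (simp add: linear_neg[OF bounded_linear.linear[OF bounded_linear_laplace_L1]])

lemma laplace_L1_scaleR: "0 < z \<Longrightarrow> laplace_L1 z (c *\<^sub>R \<phi>) = c * laplace_L1 z \<phi>"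
  by (simp add: linear_scale[OF bounded_linear.linear[OF bounded_linear_laplace_L1]])

lemma tendsto_laplace_L1: "0 < z \<Longrightarrow> (X \<longlongrightarrow> \<phi>) F \<Longrightarrow> ((\<lambda>i. laplace_L1 z (X i)) \<longlongrightarrow> laplace_L1 z \<phi>) F"
  by (rule bounded_linear.tendsto[OF bounded_linear_laplace_L1]) auto

section \<open>Averages of shifts\<close>

text \<open>Laws on the closed half-line. An atom at 0 has to be allowed: \<open>S 0\<close> is
  almost surely 0, and \<open>approx_law f n\<close> may charge 0 as well.\<close>

definition half_line_law :: "real measure \<Rightarrow> bool" where
  "half_line_law \<kappa> \<longleftrightarrow> prob_space \<kappa> \<and> sets \<kappa> = sets borel \<and> (AE t in \<kappa>. 0 \<le> t)"

lemma AE_nonneg_iff: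
  assumes "sets \<kappa> = sets borel"
  shows "(AE t in \<kappa>. 0 \<le> (t::real)) \<longleftrightarrow> emeasure \<kappa> {..<0} = 0"
proof -
  have "{t \<in> space \<kappa>. \<not> 0 \<le> t} = {..<0}"
    using sets_eq_imp_space_eq[OF assms] by auto
  then show ?thesis using assms by (subst AE_iff_measurable[of "{..<0}"]) auto
qed

lemma integrable_exp_half_line_law:
  assumes "half_line_law \<kappa>" "0 \<le> z"
  shows "integrable \<kappa> (\<lambda>t. exp (- z * t))"
proof -
  interpret prob_space \<kappa> using assms(1) by (simp add: half_line_law_def)
  have [measurable_cong]: "sets \<kappa> = sets borel" using assms(1) by (simp add: half_line_law_def)
  show ?thesis
  proof (rule integrable_const_bound[of _ 1])
    show "AE t in \<kappa>. norm (exp (- z * t)) \<le> 1"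
      using assms unfolding half_line_law_def by (auto elim!: eventually_mono)
  qed simp
qed

lemma integral_exp_half_line_law_le_1:
  assumes "half_line_law \<kappa>" "0 \<le> z"
  shows "(\<integral>t. exp (- z * t) \<partial>\<kappa>) \<le> 1"
proof -
  interpret prob_space \<kappa> using assms(1) by (simp add: half_line_law_def)
  have "(\<integral>t. exp (- z * t) \<partial>\<kappa>) \<le> (\<integral>t. 1 \<partial>\<kappa>)"
  proof (rule integral_mono_AE)
    show "AE t in \<kappa>. exp (- z * t) \<le> 1"
      using assms unfolding half_line_law_def by (auto elim!: eventually_mono)
  qed (use integrable_exp_half_line_law[OF assms] in auto)
  then show ?thesis by (simp add: prob_space)
qed

text \<open>The convolution of \<open>\<kappa>\<close> with \<open>\<phi>\<close>, as a Bochner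
  integral in \<open>L1\<close>. With \<open>\<kappa>\<close> the law of \<open>S t\<close> it is
  the subordinate semigroup.\<close>

definition shift_average :: "real measure \<Rightarrow> L1 \<Rightarrow> L1" where
  "shift_average \<kappa> \<phi> = (LINT s:{0..}|\<kappa>. shift_L1 s \<phi>)"

lemma integrable_shift_L1:
  assumes "half_line_law \<kappa>"
  shows "set_integrable \<kappa> {0..} (\<lambda>s. shift_L1 s \<phi>)"
proof -
  interpret prob_space \<kappa> using assms(1) by (simp add: half_line_law_def)
  have [measurable_cong]: "sets \<kappa> = sets borel" using assms(1) by (simp add: half_line_law_def)
  have "(\<lambda>s. indicator {0..} s *\<^sub>R shift_L1 s \<phi>) \<in> borel_measurable borel"
    by (intro borel_measurable_continuous_on_indicator continuous_on_shift_L1) simp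
  then show ?thesis
    unfolding set_integrable_def
  proof (intro integrable_const_bound[of _ "norm \<phi>"])
    show "AE s in \<kappa>. norm (indicator {0..} s *\<^sub>R shift_L1 s \<phi>) \<le> norm \<phi>"
      by (intro AE_I2) (auto simp: norm_shift_L1 split: split_indicator)
  qed simp
qed

text \<open>The Laplace transform is a bounded functional, so it commutes with the Bochner integral,
  and it multiplies the shift by \<open>s\<close> with \<open>exp (- z * s)\<close>.\<close>

lemma laplace_shift_average:
  assumes \<kappa>: "half_line_law \<kappa>" and z: "0 \<le> z"
  shows "laplace_L1 z (shift_average \<kappa> \<phi>) = (\<integral>t. exp (- z * t) \<partial>\<kappa>) * laplace_L1 z \<phi>"
proof -
  note T = bounded_linear_laplace_L1[OF z]
  have [measurable_cong]: "sets \<kappa> = sets borel" using assms(1) by (simp add: half_line_law_def)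
  have "laplace_L1 z (shift_average \<kappa> \<phi>) = (\<integral>s. laplace_L1 z (indicator {0..} s *\<^sub>R shift_L1 s \<phi>) \<partial>\<kappa>)"
    unfolding shift_average_def set_lebesgue_integral_def
    using integrable_shift_L1[OF \<kappa>, of \<phi>] unfolding set_integrable_def
    by (rule integral_bounded_linear[OF T, symmetric])
  also have "\<dots> = (\<integral>s. indicator {0..} s * (exp (- z * s) * laplace_L1 z \<phi>) \<partial>\<kappa>)"
    by (intro Bochner_Integration.integral_cong refl)
      (auto simp: linear_scale[OF bounded_linear.linear[OF T]] linear_0[OF bounded_linear.linear[OF T]]
        laplace_L1_shift split: split_indicator)
  also have "\<dots> = (\<integral>s. exp (- z * s) * laplace_L1 z \<phi> \<partial>\<kappa>)"
  proof (rule integral_cong_AE)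
    show "AE s in \<kappa>. indicator {0..} s * (exp (- z * s) * laplace_L1 z \<phi>) = exp (- z * s) * laplace_L1 z \<phi>"
    proof -
      have "AE s in \<kappa>. 0 \<le> s" using \<kappa> by (simp add: half_line_law_def)
      then show ?thesis by eventually_elim simp
    qed
  qed simp_all
  finally show ?thesis by simp
qed

text \<open>Shifts shorter than \<open>d\<close> contribute at most \<open>e\<close>. Longer ones
  contribute at most \<open>2 * norm \<phi>\<close>, and a Markov inequality controls their weight:
  \<open>1 \<le> (1 - exp (- s)) / (1 - exp (- d))\<close> for \<open>s \<ge> d\<close>. Only the
  Laplace transform of \<open>\<kappa>\<close> at 1 remains.\<close>

lemma norm_shift_average_diff_le:
  assumes \<kappa>: "half_line_law \<kappa>"
    and e: "0 \<le> e" "\<And>s. 0 \<le> s \<Longrightarrow> s < d \<Longrightarrow> norm (shift_L1 s \<phi> - \<phi>) \<le> e" and d: "0 < d"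
  shows "norm (shift_average \<kappa> \<phi> - \<phi>) \<le>
    e + 2 * norm \<phi> / (1 - exp (- d)) * (1 - (\<integral>t. exp (- 1 * t) \<partial>\<kappa>))"
proof -
  interpret prob_space \<kappa> using assms(1) by (simp add: half_line_law_def)
  have [measurable_cong]: "sets \<kappa> = sets borel" using assms(1) by (simp add: half_line_law_def)
  have pos: "AE t in \<kappa>. 0 \<le> t" using \<kappa> by (simp add: half_line_law_def)
  let ?f = "\<lambda>s. indicator {0..} s *\<^sub>R shift_L1 s \<phi>"
  let ?b = "\<lambda>s. e + 2 * norm \<phi> / (1 - exp (- d)) * (1 - exp (- 1 * s))"
  have int: "integrable \<kappa> ?f"
    using integrable_shift_L1[OF \<kappa>] by (simp add: set_integrable_def)
  note inte = integrable_exp_half_line_law[OF \<kappa>, of 1]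
  have "shift_average \<kappa> \<phi> - \<phi> = (\<integral>s. ?f s - \<phi> \<partial>\<kappa>)"
    using int by (simp add: shift_average_def set_lebesgue_integral_def prob_space)
  also have "norm \<dots> \<le> (\<integral>s. norm (?f s - \<phi>) \<partial>\<kappa>)"
    by (rule integral_norm_bound)
  also have "\<dots> \<le> (\<integral>s. ?b s \<partial>\<kappa>)"
  proof (rule integral_mono_AE)
    show "AE s in \<kappa>. norm (?f s - \<phi>) \<le> ?b s"
      using pos
    proof eventually_elim
      case (elim s)
      show ?case
      proof (cases "s < d")
        case True
        have "0 \<le> 2 * norm \<phi> / (1 - exp (- d)) * (1 - exp (- 1 * s))"
          using d elim by simp
        then show ?thesis using e(2)[OF elim True] elim by simp
      next
        case False
        have "1 - exp (- d) \<le> 1 - exp (- 1 * s)" using False by simp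
        then have "1 \<le> (1 - exp (- 1 * s)) / (1 - exp (- d))" using d by (subst le_divide_eq_1_pos) auto
        from mult_left_mono[OF this, of "2 * norm \<phi>"]
        have "2 * norm \<phi> \<le> 2 * norm \<phi> / (1 - exp (- d)) * (1 - exp (- 1 * s))" by simp
        moreover have "norm (?f s - \<phi>) \<le> 2 * norm \<phi>"
          using norm_triangle_ineq4[of "shift_L1 s \<phi>" \<phi>] norm_shift_L1[OF elim, of \<phi>] elim by simp
        ultimately show ?thesis using e(1) by linarith
      qed
    qed
    show "integrable \<kappa> ?b" using inte by simp
  qed (use int in simp)
  also have "\<dots> = e + 2 * norm \<phi> / (1 - exp (- d)) * (1 - (\<integral>t. exp (- 1 * t) \<partial>\<kappa>))"
    using inte by (simp add: prob_space)
  finally show ?thesis .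
qed

text \<open>An approximate identity criterion: convergence of the Laplace transforms to 1 at the
  single point 1 already forces the laws to concentrate at 0.\<close>

lemma shift_average_tendsto:
  assumes \<kappa>: "\<forall>\<^sub>F i in F. half_line_law (\<kappa> i)"
    and lim: "((\<lambda>i. \<integral>t. exp (- 1 * t) \<partial>\<kappa> i) \<longlongrightarrow> 1) F"
  shows "((\<lambda>i. shift_average (\<kappa> i) \<phi>) \<longlongrightarrow> \<phi>) F"
proof (rule tendstoI)
  fix e :: real assume "0 < e"
  then have e2: "0 < e / 2" by simp
  \<comment> \<open>Strong continuity at 0, where the shift is the identity, chooses
    \<open>d\<close>.\<close>
  from continuous_on_shift_L1[of \<phi>] e2
  have "\<exists>d>0. \<forall>s\<in>{0..}. dist s 0 < d \<longrightarrow> dist (shift_L1 s \<phi>) (shift_L1 0 \<phi>) < e / 2"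
    unfolding continuous_on_iff by (meson atLeast_iff order_refl)
  then obtain d where d: "d > 0" "\<And>s. 0 \<le> s \<Longrightarrow> s < d \<Longrightarrow> norm (shift_L1 s \<phi> - \<phi>) \<le> e / 2"
    by (auto simp: shift_L1_0 dist_norm less_imp_le)
  let ?c = "2 * norm \<phi> / (1 - exp (- d))"
  have "((\<lambda>i. e / 2 + ?c * (1 - (\<integral>t. exp (- 1 * t) \<partial>\<kappa> i))) \<longlongrightarrow> e / 2 + ?c * (1 - 1)) F"
    by (intro tendsto_intros lim)
  then have "\<forall>\<^sub>F i in F. e / 2 + ?c * (1 - (\<integral>t. exp (- 1 * t) \<partial>\<kappa> i)) < e"
    by (rule order_tendstoD(2)) (use e2 in simp)
  with \<kappa> show "\<forall>\<^sub>F i in F. dist (shift_average (\<kappa> i) \<phi>) \<phi> < e"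
  proof eventually_elim
    case (elim i)
    from norm_shift_average_diff_le[OF elim(1) less_imp_le[OF e2] d(2,1)] elim(2)
    show ?case unfolding dist_norm by linarith
  qed
qed

text \<open>Computes the transform of the expression in \<open>approx_derivative\<close>. There the
  integral over \<open>t\<close> is taken pointwise in \<open>x\<close> and not in
  \<open>L1\<close>, so Fubini on the product of \<open>\<kappa>\<close> and Lebesgue measure
  replaces the argument with bounded functionals.\<close>

lemma laplace_shift_difference:
  assumes \<kappa>: "half_line_law \<kappa>" and g: "integrable half_line g" and z: "0 \<le> z"
  shows "laplace_L1 z (abs_L1 (\<lambda>x. LINT t:{0<..}|\<kappa>. (zero_ext g x - zero_ext g (x - t)) * c))
    = c * (1 - (\<integral>t. exp (- z * t) \<partial>\<kappa>)) * laplace_L1 z (abs_L1 g)"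
proof -
  interpret prob_space \<kappa> using assms(1) by (simp add: half_line_law_def)
  have [measurable_cong]: "sets \<kappa> = sets borel" using assms(1) by (simp add: half_line_law_def)
  have pos: "AE t in \<kappa>. 0 \<le> t" using \<kappa> by (simp add: half_line_law_def)
  interpret pair_sigma_finite \<kappa> lborel by unfold_locales
  define G where "G = zero_ext g"
  have [measurable]: "G \<in> borel_measurable borel" unfolding G_def using g by (rule zero_ext_measurable)
  have intG: "integrable lborel G" unfolding G_def using g by (simp add: integrable_zero_ext_iff)
  define H where "H t x = indicator {0<..} t * ((G x - G (x - t)) * c)" for t x
  have [measurable]: "(\<lambda>(t, x). H t x) \<in> borel_measurable (\<kappa> \<Otimes>\<^sub>M lborel)"
    unfolding H_def by measurable
  have iGt: "integrable lborel (\<lambda>x. G (x - t))" for t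
    using intG by (simp add: integrable_shift)
  have intH: "integrable lborel (H t)" for t
    unfolding H_def by (intro integrable_mult_right integrable_mult_left Bochner_Integration.integrable_diff iGt intG)
  \<comment> \<open>By translation invariance the bound does not depend on \<open>t\<close>, so it
    is integrable against the probability law \<open>\<kappa>\<close>; this gives integrability on
    the product.\<close>
  have bound: "(\<integral>x. norm (H t x) \<partial>lborel) \<le> 2 * \<bar>c\<bar> * (\<integral>x. \<bar>G x\<bar> \<partial>lborel)" for t
  proof -
    have "(\<integral>x. norm (H t x) \<partial>lborel) \<le> (\<integral>x. \<bar>c\<bar> * (\<bar>G x\<bar> + \<bar>G (x - t)\<bar>) \<partial>lborel)"
    proof (rule integral_mono)
      show "integrable lborel (\<lambda>x. \<bar>c\<bar> * (\<bar>G x\<bar> + \<bar>G (x - t)\<bar>))"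
        by (intro integrable_mult_right Bochner_Integration.integrable_add integrable_abs iGt intG)
      show "norm (H t x) \<le> \<bar>c\<bar> * (\<bar>G x\<bar> + \<bar>G (x - t)\<bar>)" for x
        unfolding H_def using abs_triangle_ineq4[of "G x" "G (x - t)"]
        by (auto simp: abs_mult mult.commute[of "\<bar>c\<bar>"] split: split_indicator intro!: mult_right_mono)
    qed (intro integrable_norm intH)
    also have "\<dots> = \<bar>c\<bar> * ((\<integral>x. \<bar>G x\<bar> \<partial>lborel) + (\<integral>x. \<bar>G (x - t)\<bar> \<partial>lborel))"
      using intG iGt by simp
    also have "(\<integral>x. \<bar>G (x - t)\<bar> \<partial>lborel) = (\<integral>x. \<bar>G x\<bar> \<partial>lborel)"
      by (rule integral_shift)
    finally show ?thesis by (simp add: algebra_simps)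
  qed
  have int: "integrable (\<kappa> \<Otimes>\<^sub>M lborel) (\<lambda>(t, x). H t x)"
  proof (rule Fubini_integrable)
    show "integrable \<kappa> (\<lambda>t. \<integral>x. norm (case (t, x) of (t, x) \<Rightarrow> H t x) \<partial>lborel)"
      by (rule integrable_const_bound[of _ "2 * \<bar>c\<bar> * (\<integral>x. \<bar>G x\<bar> \<partial>lborel)"]) (use bound in \<open>simp_all\<close>)
  qed (use intH in simp_all)
  have h: "(LINT t:{0<..}|\<kappa>. (zero_ext g x - zero_ext g (x - t)) * c) = (\<integral>t. H t x \<partial>\<kappa>)" for x
    unfolding set_lebesgue_integral_def H_def G_def by (simp only: real_scaleR_def)
  have inth: "integrable lborel (\<lambda>x. \<integral>t. H t x \<partial>\<kappa>)"
    using int by (rule integrable_snd)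
  have "integrable half_line (\<lambda>x. \<integral>t. H t x \<partial>\<kappa>)"
    unfolding integrable_half_line_iff
    using integrable_mult_indicator[OF _ inth, of "{0<..}"] by simp
  then have "laplace_L1 z (abs_L1 (\<lambda>x. \<integral>t. H t x \<partial>\<kappa>)) =
      (\<integral>x. indicator {0<..} x * (exp (- z * x) * (\<integral>t. H t x \<partial>\<kappa>)) \<partial>lborel)"
    by (simp add: laplace_L1_abs integral_half_line)
  also have "\<dots> = (\<integral>x. (\<integral>t. indicator {0<..} x * exp (- z * x) * H t x \<partial>\<kappa>) \<partial>lborel)"
    by (simp add: mult.assoc)
  also have "\<dots> = (\<integral>t. (\<integral>x. indicator {0<..} x * exp (- z * x) * H t x \<partial>lborel) \<partial>\<kappa>)"
  proof (rule Fubini_integral)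
    show "integrable (\<kappa> \<Otimes>\<^sub>M lborel) (\<lambda>(t, x). indicator {0<..} x * exp (- z * x) * H t x)"
    proof (rule Bochner_Integration.integrable_bound[OF int])
      have "\<bar>indicator {0<..} x * exp (- z * x) * H t x\<bar> \<le> \<bar>H t x\<bar>" for t x
        using z by (auto simp: abs_mult split: split_indicator intro!: mult_left_le_one_le)
      then show "AE p in \<kappa> \<Otimes>\<^sub>M lborel. norm (case p of (t, x) \<Rightarrow> indicator {0<..} x * exp (- z * x) * H t x)
          \<le> norm (case p of (t, x) \<Rightarrow> H t x)"
        by (intro AE_I2) (simp add: split_beta)
    qed measurable
  qed
  also have "\<dots> = (\<integral>t. c * (laplace_L1 z (abs_L1 g) - exp (- z * t) * laplace_L1 z (abs_L1 g)) \<partial>\<kappa>)"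
  proof (rule integral_cong_AE)
    show "AE t in \<kappa>. (\<integral>x. indicator {0<..} x * exp (- z * x) * H t x \<partial>lborel)
      = c * (laplace_L1 z (abs_L1 g) - exp (- z * t) * laplace_L1 z (abs_L1 g))"
      using pos
    proof eventually_elim
      case (elim t)
      show ?case
      \<comment> \<open>An atom at 0 is cut off by \<open>{0<..}\<close> on the left side and
        multiplied by \<open>1 - exp 0 = 0\<close> on the right side.\<close>
      proof (cases "t = 0")
        case False
        then have t: "0 < t" using elim by simp
        have gt: "integrable half_line (\<lambda>x. zero_ext g (x - t))"
          using elim g by (rule integrable_half_line_shift)
        have "(\<integral>x. indicator {0<..} x * exp (- z * x) * H t x \<partial>lborel) =
            (\<integral>x. c * (exp (- z * x) * (g x - zero_ext g (x - t))) \<partial>half_line)"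
          unfolding integral_half_line H_def G_def using t
          by (intro Bochner_Integration.integral_cong) (auto simp: zero_ext_def split: split_indicator)
        also have "\<dots> = c * laplace_L1 z (abs_L1 g - shift_L1 t (abs_L1 g))"
          using g gt by (simp add: shift_L1_abs abs_L1_minus laplace_L1_abs)
        also have "\<dots> = c * (laplace_L1 z (abs_L1 g) - exp (- z * t) * laplace_L1 z (abs_L1 g))"
          using elim by (simp add: linear_diff[OF bounded_linear.linear[OF bounded_linear_laplace_L1[OF z]]] laplace_L1_shift)
        finally show ?thesis .
      qed (simp add: H_def)
    qed
  qed simp_all
  also have "\<dots> = c * (1 - (\<integral>t. exp (- z * t) \<partial>\<kappa>)) * laplace_L1 z (abs_L1 g)"
    using integrable_exp_half_line_law[OF \<kappa> z] by (simp add: prob_space left_diff_distrib)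
  finally show ?thesis by (simp only: h)
qed

section \<open>Subordinators at independent random times\<close>

lemma half_line_law_unique:
  assumes "half_line_law \<kappa>" "half_line_law \<kappa>'"
    and "\<And>x. 0 < x \<Longrightarrow> (\<integral>t. exp (- x * t) \<partial>\<kappa>) = (\<integral>t. exp (- x * t) \<partial>\<kappa>')"
  shows "\<kappa> = \<kappa>'"
  using assms unfolding half_line_law_def
  by (intro laplace_transform_unique) (auto simp: prob_space_def)

text \<open>Uniqueness of Laplace transforms resolves the definite description, so any law with the
  right transform may be exhibited.\<close>

lemma approx_law_eqI:
  assumes "half_line_law \<kappa>" "\<And>x. 0 < x \<Longrightarrow> (\<integral>t. exp (- x * t) \<partial>\<kappa>) = real n / (real n + f x)"
  shows "approx_law f n = \<kappa>"
  unfolding approx_law_def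
proof (rule the_equality)
  show "prob_space \<kappa> \<and> sets \<kappa> = sets borel \<and> emeasure \<kappa> {..<0} = 0 \<and>
    (\<forall>x>0. (\<integral>t. exp (- x * t) \<partial>\<kappa>) = real n / (real n + f x))"
    using assms AE_nonneg_iff[of \<kappa>] by (auto simp: half_line_law_def)
next
  fix \<rho> assume \<rho>: "prob_space \<rho> \<and> sets \<rho> = sets borel \<and> emeasure \<rho> {..<0} = 0 \<and>
    (\<forall>x>0. (\<integral>t. exp (- x * t) \<partial>\<rho>) = real n / (real n + f x))"
  then have "half_line_law \<rho>" using AE_nonneg_iff[of \<rho>] by (simp add: half_line_law_def)
  then show "\<rho> = \<kappa>" using assms \<rho> by (intro half_line_law_unique) auto
qed

lemma subordinator_AE_nonneg:
  assumes S: "subordinator P S" and t: "0 \<le> t"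
  shows "AE \<omega> in P. 0 \<le> S t \<omega>"
proof -
  have "AE \<omega> in P. S 0 \<omega> = 0" "AE \<omega> in P. mono_on {0..} (\<lambda>t. S t \<omega>)"
    using S unfolding subordinator_def by auto
  then show ?thesis
  proof eventually_elim
    case (elim \<omega>)
    then have "S 0 \<omega> \<le> S t \<omega>" using t by (intro mono_onD[of "{0..}" "\<lambda>t. S t \<omega>"]) auto
    then show ?case using elim by simp
  qed
qed

lemma subordinator_half_line_law:
  assumes S: "subordinator P S" and t: "0 \<le> t"
  shows "half_line_law (distr P borel (S t))"
proof -
  interpret prob_space P using S by (simp add: subordinator_def)
  have [measurable]: "S t \<in> borel_measurable P" using S t by (simp add: subordinator_def)
  show ?thesis
    using subordinator_AE_nonneg[OF S t] prob_space_distr[of "S t" borel]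
    unfolding half_line_law_def by (auto simp: AE_distr_iff)
qed

text \<open>Monotone paths make \<open>t \<mapsto> P (S t \<le> a)\<close> antitone, hence measurable.\<close>

lemma measurable_subordinator_law:
  assumes S: "subordinator P S"
  shows "(\<lambda>t. distr P borel (S (max 0 t))) \<in> borel \<rightarrow>\<^sub>M prob_algebra borel"
proof (rule measurable_prob_algebra_generated[where \<Omega> = UNIV and G = "range (\<lambda>a::real. {..a})"])
  interpret prob_space P using S by (simp add: subordinator_def)
  have [measurable]: "S (max 0 t) \<in> borel_measurable P" for t using S by (simp add: subordinator_def)
  show "sets borel = sigma_sets UNIV (range (\<lambda>a::real. {..a}))"
    by (subst borel_eq_atMost) simp
  show "Int_stable (range (\<lambda>a::real. {..a}))"
    by (auto simp: Int_stable_def)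
  show "prob_space (distr P borel (S (max 0 t)))" for t
    by (rule prob_space_distr) simp
  show "(\<lambda>t. emeasure (distr P borel (S (max 0 t))) A) \<in> borel_measurable borel"
    if "A \<in> range (\<lambda>a::real. {..a})" for A
  proof -
    from that obtain a where A: "A = {..a}" by blast
    have le: "prob {\<omega> \<in> space P. S (max 0 t) \<omega> \<le> a} \<le> prob {\<omega> \<in> space P. S (max 0 s) \<omega> \<le> a}"
      if "s \<le> t" for s t
    proof (rule finite_measure_mono_AE)
      have "AE \<omega> in P. mono_on {0..} (\<lambda>t. S t \<omega>)" using S unfolding subordinator_def by auto
      then show "AE \<omega> in P. \<omega> \<in> {\<omega> \<in> space P. S (max 0 t) \<omega> \<le> a} \<longrightarrow> \<omega> \<in> {\<omega> \<in> space P. S (max 0 s) \<omega> \<le> a}"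
      proof eventually_elim
        case (elim \<omega>)
        then have "S (max 0 s) \<omega> \<le> S (max 0 t) \<omega>"
          using that by (intro mono_onD[of "{0..}" "\<lambda>t. S t \<omega>"]) auto
        then show ?case by auto
      qed
    qed measurable
    have "mono (\<lambda>t. - prob {\<omega> \<in> space P. S (max 0 t) \<omega> \<le> a})"
      using le by (auto simp: mono_def)
    then have "(\<lambda>t. - prob {\<omega> \<in> space P. S (max 0 t) \<omega> \<le> a}) \<in> borel_measurable borel"
      by (rule borel_measurable_mono)
    then have [measurable]: "(\<lambda>t. prob {\<omega> \<in> space P. S (max 0 t) \<omega> \<le> a}) \<in> borel_measurable borel"
      by simp
    have "S (max 0 t) -` {..a} \<inter> space P = {\<omega> \<in> space P. S (max 0 t) \<omega> \<le> a}" for t by auto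
    then show ?thesis unfolding A
      by (simp add: emeasure_distr emeasure_eq_measure)
  qed
qed auto

text \<open>\<open>\<kappa>\<close> is the law of the subordinator at an independent random time
  with law \<open>m\<close>. Conditioning on that time gives its transform.\<close>

lemma subordinator_mixture:
  assumes S: "subordinator P S"
    and f: "\<And>t x. 0 \<le> t \<Longrightarrow> 0 < x \<Longrightarrow> (\<integral>\<omega>. exp (- x * S t \<omega>) \<partial>P) = exp (- t * f x)"
    and m: "half_line_law m"
  obtains \<kappa> where "half_line_law \<kappa>"
    "\<And>x. 0 < x \<Longrightarrow> (\<integral>s. exp (- x * s) \<partial>\<kappa>) = (\<integral>t. exp (- t * f x) \<partial>m)"
proof
  \<comment> \<open>Truncating the time at 0 makes this a kernel on the whole line. Since
    \<open>m\<close> lives on nonnegative times, the mixture is unaffected.\<close>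
  let ?N = "\<lambda>t. distr P borel (S (max 0 t))"
  define \<kappa> where "\<kappa> = m \<bind> ?N"
  have [measurable_cong]: "sets m = sets borel" using m by (simp add: half_line_law_def)
  have space: "space m = UNIV" using m sets_eq_imp_space_eq[of m borel] by (simp add: half_line_law_def)
  interpret m: prob_space m using m by (simp add: half_line_law_def)
  note N = measurable_subordinator_law[OF S]
  have Nm[measurable]: "?N \<in> m \<rightarrow>\<^sub>M subprob_algebra borel"
    using measurable_prob_algebraD[OF N] by (simp cong: measurable_cong_sets)
  have law: "half_line_law (?N t)" for t by (rule subordinator_half_line_law[OF S]) simp
  have sets[measurable_cong]: "sets \<kappa> = sets borel" unfolding \<kappa>_def
    by (rule sets_bind) (auto simp: space)
  have "prob_space \<kappa>" unfolding \<kappa>_def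
    by (rule m.prob_space_bind[OF _ Nm]) (use law in \<open>auto simp: half_line_law_def\<close>)
  moreover have "AE t in \<kappa>. 0 \<le> t" unfolding \<kappa>_def
    by (subst AE_bind[OF Nm]) (use law in \<open>auto simp: half_line_law_def\<close>)
  ultimately show \<kappa>: "half_line_law \<kappa>" using sets by (simp add: half_line_law_def)
  fix x :: real assume x: "0 < x"
  \<comment> \<open>The mixture formula is applied to nonnegative integrals and transferred back at
    the end.\<close>
  have "(\<integral>s. exp (- x * s) \<partial>\<kappa>) = enn2real (\<integral>\<^sup>+s. ennreal (exp (- x * s)) \<partial>\<kappa>)"
    by (rule integral_eq_nn_integral) auto
  also have "(\<integral>\<^sup>+s. ennreal (exp (- x * s)) \<partial>\<kappa>) = (\<integral>\<^sup>+t. \<integral>\<^sup>+s. ennreal (exp (- x * s)) \<partial>?N t \<partial>m)"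
    unfolding \<kappa>_def by (rule nn_integral_bind[OF _ Nm]) simp
  also have "\<dots> = (\<integral>\<^sup>+t. ennreal (exp (- t * f x)) \<partial>m)"
  proof (rule nn_integral_cong_AE)
    have "AE t in m. 0 \<le> t" using m by (simp add: half_line_law_def)
    then show "AE t in m. (\<integral>\<^sup>+s. ennreal (exp (- x * s)) \<partial>?N t) = ennreal (exp (- t * f x))"
    proof eventually_elim
      case (elim t)
      have [measurable]: "S t \<in> borel_measurable P" using S elim by (simp add: subordinator_def)
      have "(\<integral>\<^sup>+s. ennreal (exp (- x * s)) \<partial>?N t) = ennreal (\<integral>s. exp (- x * s) \<partial>?N t)"
        using integrable_exp_half_line_law[OF law] x by (intro nn_integral_eq_integral) auto
      also have "(\<integral>s. exp (- x * s) \<partial>?N t) = (\<integral>\<omega>. exp (- x * S t \<omega>) \<partial>P)"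
        using elim by (subst integral_distr) (auto simp: max_def)
      finally show ?case using f[OF elim x] by simp
    qed
  qed
  also have "enn2real \<dots> = (\<integral>t. exp (- t * f x) \<partial>m)"
    by (rule integral_eq_nn_integral[symmetric]) auto
  finally show "(\<integral>s. exp (- x * s) \<partial>\<kappa>) = (\<integral>t. exp (- t * f x) \<partial>m)" .
qed

section \<open>Exponential and uniform random times\<close>

lemma half_line_law_exponential:
  assumes "0 < l"
  shows "half_line_law (density lborel (exponential_density l))"
  unfolding half_line_law_def using prob_space_exponential_density[OF assms]
  by (subst AE_density) (auto simp: exponential_density_def intro!: AE_I2)

lemma integral_exponential_density:
  assumes "0 < l"
  shows "(\<integral>x. exponential_density l x \<partial>lborel) = 1"
proof -
  interpret prob_space "density lborel (exponential_density l)"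
    using assms by (rule prob_space_exponential_density)
  have "(\<integral>x. exponential_density l x \<partial>lborel) = (\<integral>x. 1 \<partial>density lborel (exponential_density l))"
    using assms by (subst integral_density) (auto simp: exponential_density_nonneg)
  then show ?thesis using prob_space by simp
qed

text \<open>Multiplication by \<open>exp (- t * c)\<close> turns the exponential density of rate
  \<open>l\<close> into that of rate \<open>l + c\<close>, up to the factor
  \<open>l / (l + c)\<close>. With \<open>l = n\<close> and \<open>c = f x\<close> this is the
  transform demanded of \<open>approx_law f n\<close>.\<close>

lemma laplace_exponential:
  assumes l: "0 < l" and c: "0 \<le> c"
  shows "(\<integral>t. exp (- t * c) \<partial>density lborel (exponential_density l)) = l / (l + c)"
proof -
  have "(\<integral>t. exp (- t * c) \<partial>density lborel (exponential_density l)) =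
      (\<integral>t. exponential_density l t * exp (- t * c) \<partial>lborel)"
    using l by (subst integral_density) (auto simp: exponential_density_nonneg)
  also have "\<dots> = (\<integral>t. l / (l + c) * exponential_density (l + c) t \<partial>lborel)"
  proof (rule Bochner_Integration.integral_cong[OF refl])
    fix t
    have "exp (- t * l) * exp (- t * c) = exp (- t * (l + c))"
      by (simp add: exp_add[symmetric] distrib_left)
    then show "exponential_density l t * exp (- t * c) = l / (l + c) * exponential_density (l + c) t"
      using l c by (simp add: exponential_density_def)
  qed
  finally show ?thesis using l c integral_exponential_density[of "l + c"] by simp
qed

lemma half_line_law_uniform:
  assumes "0 < (t::real)"
  shows "half_line_law (uniform_measure lborel {0..t})"
  unfolding half_line_law_def using assms
  by (auto intro!: prob_space_uniform_measure AE_uniform_measureI)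

text \<open>Cleared of the denominator \<open>t * c\<close>, so that \<open>c = 0\<close> needs no
  separate case.\<close>

lemma laplace_uniform:
  assumes t: "0 < (t::real)"
  shows "t * c * (\<integral>s. exp (- s * c) \<partial>uniform_measure lborel {0..t}) = 1 - exp (- t * c)"
proof -
  have "uniform_measure lborel {0..t} = density lborel (\<lambda>s. ennreal (indicator {0..t} s / t))"
    unfolding uniform_measure_def using t
    by (intro density_cong) (auto simp: divide_ennreal[symmetric] split: split_indicator intro!: AE_I2)
  then have "(\<integral>s. exp (- s * c) \<partial>uniform_measure lborel {0..t}) = (\<integral>s. indicator {0..t} s / t * exp (- s * c) \<partial>lborel)"
    using t by (simp only:, subst integral_density) auto
  then have "t * c * (\<integral>s. exp (- s * c) \<partial>uniform_measure lborel {0..t}) =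
      (\<integral>s. t * c * (indicator {0..t} s / t * exp (- s * c)) \<partial>lborel)"
    by simp
  also have "\<dots> = (\<integral>s. c * exp (- s * c) * indicator {0..t} s \<partial>lborel)"
    using t by (intro Bochner_Integration.integral_cong) auto
  also have "\<dots> = - exp (- t * c) - - exp (- 0 * c)"
    using t by (intro integral_FTC_Icc_real[where F = "\<lambda>s. - exp (- s * c)"]) (auto intro!: derivative_eq_intros continuous_intros)
  finally show ?thesis by simp
qed

text \<open>All sampled times are at most \<open>t\<close>. The bound tends to 1 as \<open>t\<close>
  tends to 0 and is informative also for \<open>c = 0\<close>.\<close>

lemma laplace_uniform_ge:
  assumes t: "0 < (t::real)" and c: "0 \<le> c"
  shows "exp (- t * c) \<le> (\<integral>s. exp (- s * c) \<partial>uniform_measure lborel {0..t})"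
proof -
  interpret prob_space "uniform_measure lborel {0..t}"
    using half_line_law_uniform[OF t] by (simp add: half_line_law_def)
  have "(\<integral>s. exp (- t * c) \<partial>uniform_measure lborel {0..t}) \<le> (\<integral>s. exp (- s * c) \<partial>uniform_measure lborel {0..t})"
  proof (rule integral_mono_AE)
    show "integrable (uniform_measure lborel {0..t}) (\<lambda>s. exp (- s * c))"
      using integrable_exp_half_line_law[OF half_line_law_uniform[OF t] c] by (simp add: mult.commute)
    show "AE s in uniform_measure lborel {0..t}. exp (- t * c) \<le> exp (- s * c)"
      by (rule AE_uniform_measureI) (use c in \<open>auto intro!: AE_I2 mult_right_mono\<close>)
  qed simp
  then show ?thesis using prob_space by simp
qed

section \<open>The generator of the subordinate shift semigroup\<close>

context
  fixes f :: "real \<Rightarrow> real" and P :: "'w measure" and S :: "real \<Rightarrow> 'w \<Rightarrow> real"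
  assumes S: "subordinator P S"
    and laplace_S: "\<And>t x. 0 \<le> t \<Longrightarrow> 0 < x \<Longrightarrow> (\<integral>\<omega>. exp (- x * S t \<omega>) \<partial>P) = exp (- t * f x)"
    and f_nonneg: "\<And>x. 0 < x \<Longrightarrow> 0 \<le> f x"
begin

text \<open>Existence of the law: \<open>approx_law f n\<close> is the law of the subordinator at an
  independent exponential time of rate \<open>n\<close>.\<close>

lemma
  assumes n: "0 < n"
  shows half_line_law_approx_law: "half_line_law (approx_law f n)"
    and laplace_approx_law: "0 < x \<Longrightarrow> (\<integral>t. exp (- x * t) \<partial>approx_law f n) = real n / (real n + f x)"
proof -
  obtain \<kappa> where \<kappa>: "half_line_law \<kappa>"
    "\<And>x. 0 < x \<Longrightarrow> (\<integral>s. exp (- x * s) \<partial>\<kappa>) =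
      (\<integral>t. exp (- t * f x) \<partial>density lborel (exponential_density (real n)))"
    using subordinator_mixture[OF S laplace_S half_line_law_exponential[of "real n"]] n by auto
  then have *: "(\<integral>s. exp (- x * s) \<partial>\<kappa>) = real n / (real n + f x)" if "0 < x" for x
    using laplace_exponential[of "real n" "f x"] that n f_nonneg by simp
  have "approx_law f n = \<kappa>" by (rule approx_law_eqI[OF \<kappa>(1) *])
  then show "half_line_law (approx_law f n)"
    "0 < x \<Longrightarrow> (\<integral>t. exp (- x * t) \<partial>approx_law f n) = real n / (real n + f x)"
    using \<kappa>(1) * by simp_all
qed

text \<open>The factor \<open>n * (1 - n / (n + f z))\<close> is regrouped as the transform of
  \<open>approx_law f n\<close> times \<open>f z\<close>, which isolates the transform expected of
  the limit.\<close>

lemma laplace_approx_derivative: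
  assumes n: "0 < n" and z: "0 < z"
  shows "laplace_L1 z (approx_derivative f n \<phi>) = real n / (real n + f z) * (f z * laplace_L1 z \<phi>)"
proof -
  have "real n + f z \<noteq> 0" using n f_nonneg[OF z] by (simp add: add_pos_nonneg less_imp_neq[symmetric])
  then have eq: "real n * (1 - real n / (real n + f z)) = real n / (real n + f z) * f z"
    by (simp add: field_simps)
  have "laplace_L1 z (approx_derivative f n \<phi>) = real n * (1 - real n / (real n + f z)) * laplace_L1 z \<phi>"
    unfolding approx_derivative_def laplace_approx_law[OF n z, symmetric]
    using laplace_shift_difference[OF half_line_law_approx_law[OF n] integrable_rep_L1 less_imp_le[OF z]] by simp
  then show ?thesis unfolding eq by (simp only: mult.assoc)
qed

lemma approx_factor_tendsto:
  assumes "0 < z"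
  shows "(\<lambda>n. real n / (real n + f z)) \<longlonglongrightarrow> 1"
proof -
  have "(\<lambda>n. inverse (1 + f z * inverse (real n))) \<longlonglongrightarrow> inverse (1 + f z * 0)"
    by (intro tendsto_intros lim_inverse_n) simp
  moreover have "\<forall>\<^sub>F n in sequentially. inverse (1 + f z * inverse (real n)) = real n / (real n + f z)"
    using eventually_gt_at_top[of 0]
    by eventually_elim (use f_nonneg[OF assms] in \<open>simp add: field_simps\<close>)
  ultimately have "(\<lambda>n. real n / (real n + f z)) \<longlonglongrightarrow> inverse (1 + f z * 0)"
    by (rule Lim_transform_eventually)
  then show ?thesis by simp
qed

text \<open>Removes the approximations from the definition of the derivative. Forward, the
  transforms converge with factor tending to 1. Backward, the approximating derivatives of
  \<open>\<phi>\<close> are averages of shifts of \<open>\<psi>\<close>.\<close>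

lemma approx_derivative_tendsto_iff:
  "(\<lambda>n. norm (approx_derivative f n \<phi> - \<psi>)) \<longlonglongrightarrow> 0 \<longleftrightarrow>
    (\<forall>z>0. laplace_L1 z \<psi> = f z * laplace_L1 z \<phi>)"
proof
  assume "(\<lambda>n. norm (approx_derivative f n \<phi> - \<psi>)) \<longlonglongrightarrow> 0"
  then have lim: "(\<lambda>n. approx_derivative f n \<phi>) \<longlonglongrightarrow> \<psi>"
    by (simp add: tendsto_norm_zero_iff LIM_zero_iff)
  show "\<forall>z>0. laplace_L1 z \<psi> = f z * laplace_L1 z \<phi>"
  proof (intro allI impI)
    fix z :: real assume z: "0 < z"
    have "(\<lambda>n. real n / (real n + f z) * (f z * laplace_L1 z \<phi>)) \<longlonglongrightarrow> 1 * (f z * laplace_L1 z \<phi>)"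
      by (intro tendsto_intros approx_factor_tendsto z)
    moreover have "\<forall>\<^sub>F n in sequentially. real n / (real n + f z) * (f z * laplace_L1 z \<phi>)
        = laplace_L1 z (approx_derivative f n \<phi>)"
      using eventually_gt_at_top[of 0] by eventually_elim (simp add: laplace_approx_derivative z)
    ultimately have "(\<lambda>n. laplace_L1 z (approx_derivative f n \<phi>)) \<longlonglongrightarrow> 1 * (f z * laplace_L1 z \<phi>)"
      by (rule Lim_transform_eventually)
    from LIMSEQ_unique[OF tendsto_laplace_L1[OF z lim] this] show "laplace_L1 z \<psi> = f z * laplace_L1 z \<phi>"
      by simp
  qed
next
  assume eq: "\<forall>z>0. laplace_L1 z \<psi> = f z * laplace_L1 z \<phi>"
  have "(\<lambda>n. shift_average (approx_law f n) \<psi>) \<longlonglongrightarrow> \<psi>"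
  proof (rule shift_average_tendsto)
    show "\<forall>\<^sub>F n in sequentially. half_line_law (approx_law f n)"
      \<comment> \<open>The index \<open>n = 0\<close> is discarded: the prescribed transform would
        be 0, which no probability law on the half-line has.\<close>
      using eventually_gt_at_top[of 0] by eventually_elim (rule half_line_law_approx_law)
    have "\<forall>\<^sub>F n in sequentially. real n / (real n + f 1) = (\<integral>t. exp (- 1 * t) \<partial>approx_law f n)"
      using eventually_gt_at_top[of 0] by eventually_elim (rule laplace_approx_law[symmetric], auto)
    with approx_factor_tendsto[OF zero_less_one]
    show "(\<lambda>n. \<integral>t. exp (- 1 * t) \<partial>approx_law f n) \<longlonglongrightarrow> 1"
      by (rule Lim_transform_eventually)
  qed
  \<comment> \<open>Both sides have the transform
    \<open>n / (n + f z) * (f z * laplace_L1 z \<phi>)\<close>; injectivity identifies them.\<close>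
  moreover have "\<forall>\<^sub>F n in sequentially. shift_average (approx_law f n) \<psi> = approx_derivative f n \<phi>"
    using eventually_gt_at_top[of 0]
  proof eventually_elim
    case (elim n)
    show ?case
    proof (rule laplace_L1_inj)
      fix z :: real assume "0 < z"
      then show "laplace_L1 z (shift_average (approx_law f n) \<psi>) = laplace_L1 z (approx_derivative f n \<phi>)"
        using elim eq laplace_approx_law[OF elim, of z]
        by (simp add: laplace_shift_average[OF half_line_law_approx_law] laplace_approx_derivative)
    qed
  qed
  ultimately have "(\<lambda>n. approx_derivative f n \<phi>) \<longlonglongrightarrow> \<psi>"
    by (rule Lim_transform_eventually)
  then show "(\<lambda>n. norm (approx_derivative f n \<phi> - \<psi>)) \<longlonglongrightarrow> 0"
    by (simp add: tendsto_norm_zero_iff LIM_zero_iff)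
qed

section \<open>Difference quotients of the subordinate semigroup\<close>

lemma subordinate_shift_average:
  "subordinate P S shift_L1 t = shift_average (distr P borel (S t))"
  by (rule ext) (simp add: subordinate_def shift_average_def)

lemma laplace_subordinate:
  assumes t: "0 \<le> t" and z: "0 < z"
  shows "laplace_L1 z (subordinate P S shift_L1 t \<phi>) = exp (- t * f z) * laplace_L1 z \<phi>"
proof -
  have [measurable]: "S t \<in> borel_measurable P" using S t by (simp add: subordinator_def)
  have "(\<integral>s. exp (- z * s) \<partial>distr P borel (S t)) = exp (- t * f z)"
    by (subst integral_distr) (use laplace_S[OF t z] in auto)
  then show ?thesis
    using z by (simp add: subordinate_shift_average laplace_shift_average[OF subordinator_half_line_law[OF S t]])
qed

lemma laplace_difference_quotient_subordinate:
  assumes "0 < t" "0 < z"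
  shows "laplace_L1 z ((subordinate P S shift_L1 t \<phi> - \<phi>) /\<^sub>R t) = (exp (- t * f z) - 1) / t * laplace_L1 z \<phi>"
proof -
  have "laplace_L1 z ((subordinate P S shift_L1 t \<phi> - \<phi>) /\<^sub>R t) =
      inverse t * (exp (- t * f z) * laplace_L1 z \<phi> - laplace_L1 z \<phi>)"
    using assms laplace_subordinate[of t z \<phi>] by (simp only: laplace_L1_scaleR laplace_L1_diff)
  also have "\<dots> = (exp (- t * f z) - 1) / t * laplace_L1 z \<phi>"
    by (simp add: algebra_simps divide_inverse)
  finally show ?thesis .
qed

text \<open>Averaging shifts under this law amounts to taking the mean of the subordinate semigroup
  over the times in \<open>[0, t]\<close>. The generator maps such a mean to a difference quotient,
  and the last identity is this fact for transforms.\<close>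

lemma uniform_mixture:
  assumes t: "0 < t"
  obtains \<kappa> where "half_line_law \<kappa>" "exp (- t * f 1) \<le> (\<integral>s. exp (- 1 * s) \<partial>\<kappa>)"
    "\<And>z. 0 < z \<Longrightarrow> t * f z * (\<integral>s. exp (- z * s) \<partial>\<kappa>) = 1 - exp (- t * f z)"
proof -
  obtain \<kappa> where \<kappa>: "half_line_law \<kappa>"
    "\<And>x. 0 < x \<Longrightarrow> (\<integral>s. exp (- x * s) \<partial>\<kappa>) = (\<integral>s. exp (- s * f x) \<partial>uniform_measure lborel {0..t})"
    using subordinator_mixture[OF S laplace_S half_line_law_uniform[OF t]] by auto
  show thesis
    by (rule that[OF \<kappa>(1)])
      (use laplace_uniform[OF t] laplace_uniform_ge[OF t f_nonneg] in \<open>simp_all only: \<kappa>(2) zero_less_one\<close>)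
qed

text \<open>The counterpart of \<open>approx_derivative_tendsto_iff\<close> for the semigroup, with
  uniform times in place of exponential ones and the sign of the generator
  \<open>- f(d/dx)\<close>.\<close>

lemma subordinate_difference_quotient_tendsto_iff:
  "((\<lambda>t. (subordinate P S shift_L1 t \<phi> - \<phi>) /\<^sub>R t) \<longlongrightarrow> \<psi>) (at_right 0) \<longleftrightarrow>
    (\<forall>z>0. laplace_L1 z \<psi> = - f z * laplace_L1 z \<phi>)"
proof
  assume lim: "((\<lambda>t. (subordinate P S shift_L1 t \<phi> - \<phi>) /\<^sub>R t) \<longlongrightarrow> \<psi>) (at_right 0)"
  show "\<forall>z>0. laplace_L1 z \<psi> = - f z * laplace_L1 z \<phi>"
  proof (intro allI impI)
    fix z :: real assume z: "0 < z"
    \<comment> \<open>On the level of transforms the difference quotient is that of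
      \<open>exp (- t * f z)\<close> at 0.\<close>
    have "((\<lambda>t. exp (- t * f z)) has_real_derivative - f z) (at 0)"
      by (auto intro!: derivative_eq_intros)
    then have "((\<lambda>t. (exp (- t * f z) - 1) / t) \<longlongrightarrow> - f z) (at_right 0)"
      unfolding has_field_derivative_iff by (simp add: tendsto_within_subset[OF _ subset_UNIV])
    then have "((\<lambda>t. (exp (- t * f z) - 1) / t * laplace_L1 z \<phi>) \<longlongrightarrow> - f z * laplace_L1 z \<phi>) (at_right 0)"
      by (intro tendsto_intros)
    moreover have "\<forall>\<^sub>F t in at_right 0. (exp (- t * f z) - 1) / t * laplace_L1 z \<phi>
        = laplace_L1 z ((subordinate P S shift_L1 t \<phi> - \<phi>) /\<^sub>R t)"
      using eventually_at_right_less[of 0] by eventually_elim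
        (rule laplace_difference_quotient_subordinate[OF _ z, symmetric])
    ultimately have "((\<lambda>t. laplace_L1 z ((subordinate P S shift_L1 t \<phi> - \<phi>) /\<^sub>R t)) \<longlongrightarrow> - f z * laplace_L1 z \<phi>) (at_right 0)"
      by (rule Lim_transform_eventually)
    with tendsto_laplace_L1[OF z lim] show "laplace_L1 z \<psi> = - f z * laplace_L1 z \<phi>"
      by (rule tendsto_unique[rotated]) simp
  qed
next
  assume eq: "\<forall>z>0. laplace_L1 z \<psi> = - f z * laplace_L1 z \<phi>"
  \<comment> \<open>A choice of one mixture law for every positive \<open>t\<close>.\<close>
  obtain \<kappa> where \<kappa>: "\<And>t. 0 < t \<Longrightarrow> half_line_law (\<kappa> t)"
    "\<And>t. 0 < t \<Longrightarrow> exp (- t * f 1) \<le> (\<integral>s. exp (- 1 * s) \<partial>\<kappa> t)"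
    "\<And>t z. 0 < t \<Longrightarrow> 0 < z \<Longrightarrow> t * f z * (\<integral>s. exp (- z * s) \<partial>\<kappa> t) = 1 - exp (- t * f z)"
  proof -
    have "\<exists>\<kappa>. half_line_law \<kappa> \<and> exp (- t * f 1) \<le> (\<integral>s. exp (- 1 * s) \<partial>\<kappa>) \<and>
        (\<forall>z>0. t * f z * (\<integral>s. exp (- z * s) \<partial>\<kappa>) = 1 - exp (- t * f z))" if t: "0 < t" for t
    proof -
      obtain \<kappa> where "half_line_law \<kappa>" "exp (- t * f 1) \<le> (\<integral>s. exp (- 1 * s) \<partial>\<kappa>)"
        "\<And>z. 0 < z \<Longrightarrow> t * f z * (\<integral>s. exp (- z * s) \<partial>\<kappa>) = 1 - exp (- t * f z)"
        using t by (rule uniform_mixture) (rule that)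
      then show ?thesis by blast
    qed
    then show thesis using that by metis
  qed
  have "((\<lambda>t. shift_average (\<kappa> t) \<psi>) \<longlongrightarrow> \<psi>) (at_right 0)"
  proof (rule shift_average_tendsto)
    show "\<forall>\<^sub>F t in at_right 0. half_line_law (\<kappa> t)"
      using eventually_at_right_less[of 0] by eventually_elim (rule \<kappa>)
    show "((\<lambda>t. \<integral>s. exp (- 1 * s) \<partial>\<kappa> t) \<longlongrightarrow> 1) (at_right 0)"
    \<comment> \<open>The transform at 1 lies between \<open>exp (- t * f 1)\<close> and 1, so the
      laws concentrate at 0 as \<open>t\<close> decreases.\<close>
    proof (rule tendsto_sandwich)
      show "\<forall>\<^sub>F t in at_right 0. exp (- t * f 1) \<le> (\<integral>s. exp (- 1 * s) \<partial>\<kappa> t)"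
        using eventually_at_right_less[of 0] by eventually_elim (rule \<kappa>)
      show "\<forall>\<^sub>F t in at_right 0. (\<integral>s. exp (- 1 * s) \<partial>\<kappa> t) \<le> 1"
        using eventually_at_right_less[of 0] by eventually_elim (rule integral_exp_half_line_law_le_1[OF \<kappa>(1)], auto)
      have "((\<lambda>t. exp (- t * f 1)) \<longlongrightarrow> exp (- 0 * f 1)) (at_right 0)"
        by (intro tendsto_intros)
      then show "((\<lambda>t. exp (- t * f 1)) \<longlongrightarrow> 1) (at_right 0)" by simp
    qed simp
  qed
  moreover have "\<forall>\<^sub>F t in at_right 0. shift_average (\<kappa> t) \<psi> = (subordinate P S shift_L1 t \<phi> - \<phi>) /\<^sub>R t"
    using eventually_at_right_less[of 0]
  proof eventually_elim
    case (elim t)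
    show ?case
    proof (rule laplace_L1_inj)
      fix z :: real assume z: "0 < z"
      define k where "k = (\<integral>s. exp (- z * s) \<partial>\<kappa> t)"
      have k: "exp (- t * f z) - 1 = - (t * f z * k)"
        unfolding k_def using \<kappa>(3)[OF elim z] by simp
      have "laplace_L1 z ((subordinate P S shift_L1 t \<phi> - \<phi>) /\<^sub>R t) =
          (exp (- t * f z) - 1) / t * laplace_L1 z \<phi>"
        using elim z by (rule laplace_difference_quotient_subordinate)
      \<comment> \<open>After \<open>t\<close> cancels, \<open>- f z * laplace_L1 z \<phi>\<close>
        is the transform of \<open>\<psi>\<close> by assumption.\<close>
      also have "\<dots> = k * laplace_L1 z \<psi>"
        using elim eq z by (simp only: k) simp
      also have "\<dots> = laplace_L1 z (shift_average (\<kappa> t) \<psi>)"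
        using z by (simp add: laplace_shift_average[OF \<kappa>(1)[OF elim]] k_def)
      finally show "laplace_L1 z (shift_average (\<kappa> t) \<psi>) = laplace_L1 z ((subordinate P S shift_L1 t \<phi> - \<phi>) /\<^sub>R t)" ..
    qed
  qed
  ultimately show "((\<lambda>t. (subordinate P S shift_L1 t \<phi> - \<phi>) /\<^sub>R t) \<longlongrightarrow> \<psi>) (at_right 0)"
    by (rule Lim_transform_eventually)
qed

section \<open>Comparison of the generator with the Bernstein-Riemann-Liouville derivative\<close>

lemma generator_tendsto_iff_BRL:
  "((\<lambda>t. (subordinate P S shift_L1 t \<phi> - \<phi>) /\<^sub>R t) \<longlongrightarrow> - \<psi>) (at_right 0) \<longleftrightarrow>
    (\<lambda>n. norm (approx_derivative f n \<phi> - \<psi>)) \<longlonglongrightarrow> 0"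
  unfolding subordinate_difference_quotient_tendsto_iff approx_derivative_tendsto_iff
  by (auto simp: laplace_L1_minus)

lemma generator_domain_subordinate: "generator_domain (subordinate P S shift_L1) = BRL_domain f"
proof -
  \<comment> \<open>The two limits differ by a sign, which the existential quantifier absorbs by
    replacing \<open>\<psi>\<close> with \<open>- \<psi>\<close>.\<close>
  have "(\<exists>\<psi>. ((\<lambda>t. (subordinate P S shift_L1 t \<phi> - \<phi>) /\<^sub>R t) \<longlongrightarrow> \<psi>) (at_right 0)) \<longleftrightarrow>
      (\<exists>\<psi>. ((\<lambda>t. (subordinate P S shift_L1 t \<phi> - \<phi>) /\<^sub>R t) \<longlongrightarrow> - \<psi>) (at_right 0))" for \<phi>
    by (rule iffI; erule exE) (rule exI, subst minus_minus, assumption, rule exI, assumption)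
  then show ?thesis
    by (simp only: generator_domain_def BRL_domain_def generator_tendsto_iff_BRL)
qed

lemma generator_subordinate:
  assumes "\<phi> \<in> BRL_domain f"
  shows "- generator (subordinate P S shift_L1) \<phi> = BRL_derivative f \<phi>"
proof -
  obtain \<psi> where \<psi>: "(\<lambda>n. norm (approx_derivative f n \<phi> - \<psi>)) \<longlonglongrightarrow> 0"
    using assms by (auto simp: BRL_domain_def)
  have "BRL_derivative f \<phi> = \<psi>"
    unfolding BRL_derivative_def
  proof (rule the_equality)
    fix \<psi>' assume "(\<lambda>n. norm (approx_derivative f n \<phi> - \<psi>')) \<longlonglongrightarrow> 0"
    with \<psi> show "\<psi>' = \<psi>"
      by (intro LIMSEQ_unique[of "\<lambda>n. approx_derivative f n \<phi>"]) (simp_all add: tendsto_norm_zero_iff LIM_zero_iff)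
  qed (rule \<psi>)
  moreover have "generator (subordinate P S shift_L1) \<phi> = - \<psi>"
    unfolding generator_def using \<psi> by (intro tendsto_Lim) (simp_all add: generator_tendsto_iff_BRL)
  ultimately show ?thesis by simp
qed

end

theorem corollary2p3:
  fixes f :: "real \<Rightarrow> real" and \<mu> :: "real measure"
    and P :: "'w measure" and S :: "real \<Rightarrow> 'w \<Rightarrow> real"
  assumes "bernstein_triplet f 0 0 \<mu>"
    and "subordinator P S"
    and "\<And>t x. 0 \<le> t \<Longrightarrow> 0 < x \<Longrightarrow> (\<integral>\<omega>. exp (- x * S t \<omega>) \<partial>P) = exp (- t * f x)"
  shows "generator_domain (subordinate P S shift_L1) = BRL_domain f \<and>
    (\<forall>\<phi>\<in>BRL_domain f. - generator (subordinate P S shift_L1) \<phi> = BRL_derivative f \<phi>)"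
proof -
  \<comment> \<open>Read off from the subordinator at time 1: \<open>S 1\<close> is almost surely
    nonnegative, so \<open>exp (- f x)\<close> is the expectation of a variable that is at most
    1.\<close>
  have f_nonneg: "0 \<le> f x" if x: "0 < x" for x
  proof -
    have "(\<integral>s. exp (- x * s) \<partial>distr P borel (S 1)) \<le> 1"
      using subordinator_half_line_law[OF assms(2), of 1] x by (intro integral_exp_half_line_law_le_1) auto
    moreover have "S 1 \<in> borel_measurable P" using assms(2) by (simp add: subordinator_def)
    ultimately have "exp (- 1 * f x) \<le> 1"
      using assms(3)[of 1 x] x by (subst (asm) integral_distr) auto
    then show ?thesis by simp
  qed
  show ?thesis
  proof (intro conjI ballI)
    show "generator_domain (subordinate P S shift_L1) = BRL_domain f"
      by (rule generator_domain_subordinate[OF assms(2,3) f_nonneg])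
    show "- generator (subordinate P S shift_L1) \<phi> = BRL_derivative f \<phi>" if "\<phi> \<in> BRL_domain f" for \<phi>
      by (rule generator_subordinate[OF assms(2,3) f_nonneg that])
  qed
qed

end
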